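(* Let $\gamma\in[0,1)$, let $(\mathbf{d}(0),\mathbf{d}(1))$ be a probability vector, put $\mathbf{d}^\gamma_s=(1-\gamma)\mathbf{d}(s)$ for $s\in\{0,1\}$, and let $p_0,p_1\in[0,1]$ with $p_1\ge\frac12>p_0$. Define $$\Phi_{\pm}(a)=(\pm1+\gamma p_0+\gamma p_1)\log\left(\frac{1-a}{a}\right)-2\gamma\log(1-a).$$ Let $\psi_0\in[0,\frac12]$ be the solution of $\Phi_+(\psi_0)=\Phi_-(p_1)$, and let $\psi_1\in[\frac12,1]$ be the solution of $\Phi_-(\psi_1)=\Phi_+(p_0)$. Let $u$ be the unit step function, and define $$b_l'=2\left(\frac{\mathbf{d}^\gamma_0+\gamma p_1}{1-\gamma\psi_0+\gamma p_1}\right)(\psi_0-p_0)\,u(1-p_0-p_1)+2\left(\frac{1-\gamma p_0-\mathbf{d}^\gamma_0}{1-\gamma p_0+\gamma\psi_1}\right)(p_1-\psi_1)\,u(-1+p_0+p_1),$$ $$b_h'=(2\mathbf{d}^\gamma_0+\gamma)(1-p_0-p_1)+2p_1-1,$$ $$\eta_0^{+}(b)=\frac{\frac b2(1+\gamma p_1)+p_0(\mathbf{d}^\gamma_0+\gamma p_1)}{(\gamma p_1+\mathbf{d}^\gamma_0)+\gamma\frac b2},\qquad \eta_1^{-}(b)=\frac{\frac b2(1-\gamma p_0)-p_1(1-\gamma p_0-\mathbf{d}^\gamma_0)}{-(1-\gamma p_0-\mathbf{d}^\gamma_0)-\gamma\frac b2},$$ $$m(a_0,a_1)=d_0(a_0-p_0)+d_1(p_1-a_1),\quad\text{where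 } d_0=\frac{\mathbf{d}^\gamma_0+\gamma a_1}{1-\gamma a_0+\gamma a_1},\ \ d_1=\frac{1-\gamma a_0-\mathbf{d}^\gamma_0}{1-\gamma a_0+\gamma a_1}.$$ Then for every $b\ge0$, an optimal policy for the problem $\mathbf{P1}$ (defined in the context) with cost budget $b$ is the deterministic stationary policy that chooses action $a_s$ in state $s\in\{0,1\}$, where: 1. if $b\in[0,b_l')$: $a_0=p_0$ and $a_1=\eta_1^{-}(b)$ when $|\frac12-p_1|\ge|\frac12-p_0|$; and $a_0=\eta_0^{+}(b)$ and $a_1=p_1$ when $|\frac12-p_1|<|\frac12-p_0|$; 2. if $b\in[b_l',b_h']$: $(a_0,a_1)\in S_b$, where $$S_b=\left\{(a_0,a_1)\in[p_0,\tfrac12]\times[\tfrac12,p_1]\ :\ \Phi_-(a_1)=\Phi_+(a_0)\ \text{ and }\ m(a_0,a_1)=\tfrac b2\right\}$$ (that is, such a pair exists, and it gives an optimal policy); 3. if $b\in(b_h',\infty)$: $a_0=a_1=\frac12$.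
   Context: This is a two-state constrained Markov decision process with states $\{0,1\}$, action set $[0,1]$ (action $a$ moves to state $0$ with probability $a$ and to state $1$ with probability $1-a$, whatever the current state), discount factor $\gamma$, initial distribution $\mathbf{d}$, reward $H(a)$ and cost $\mathrm{TV}_s(a)$. Notation: $H(a)=-a\log a-(1-a)\log(1-a)$ is the binary entropy function (with $0\log 0=0$), and $\mathrm{TV}_s(a)=|a-p_s|+|(1-a)-(1-p_s)|=2|a-p_s|$. Problem $\mathbf{P1}$. The variables are two finite nonnegative Borel measures $d(0,\cdot),d(1,\cdot)$ on $[0,1]$ (discounted state-action occupancy measures; point masses are allowed, and one writes $d(s,a)\,da$ for integration against $d(s,\cdot)$). Maximize $$\sum_{s=0}^1\int_0^1 H(a)\,d(s,a)\,da$$ subject to $$\int_0^1\Big(d(0,a)-\sum_{s=0}^1\gamma a\,d(s,a)\Big)da=\mathbf{d}^\gamma_0,$$ $$\int_0^1\Big(d(1,a)-\sum_{s=0}^1\gamma(1-a)\,d(s,a)\Big)da=\mathbf{d}^\gamma_1,$$ $$\sum_{s=0}^1\int_0^1\mathrm{TV}_s(a)\,d(s,a)\,da\le b .$$ The deterministic stationary policy choosing $a_s\in[0,1]$ in state $s$ has occupancy measure $d(s,\cdot)=d_s\,\delta_{a_s}$ (Dirac mass at $a_s$), with $$d_0=\frac{\mathbf{d}^\gamma_0+\gamma a_1}{1-\gamma a_0+\gamma a_1},\qquad d_1=1-d_0=\frac{1-\gamma a_0-\mathbf{d}^\gamma_0}{1-\gamma a_0+\gamma a_1}.$$ The policy is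 called optimal if this occupancy measure is feasible for $\mathbf{P1}$ and attains the maximum of the objective of $\mathbf{P1}$. Conventions: $\Phi_+$ is considered on $[0,\frac12]$ and $\Phi_-$ on $[\frac12,1]$, with the limiting values $\Phi_+(0)=+\infty$ and $\Phi_-(1)=+\infty$; on these intervals $\Phi_+$ is strictly decreasing and $\Phi_-$ is strictly increasing, with $\Phi_+(\frac12)=\Phi_-(\frac12)$, so $\psi_0$ and $\psi_1$ are well defined. The unit step function is $u(x)=1$ for $x>0$ and $u(x)=0$ for $x<0$; the value $u(0)$ is immaterial, because when $p_0+p_1=1$ one has $\psi_0=p_0$ and $\psi_1=p_1$. *)

theory Defs
  imports "HOL-Probability.Probability"
begin

text \<open>
  Throughout, \<open>\<gamma>\<close> is the discount factor, \<open>d0\<close> and \<open>d1\<close> are the initial probabilities of the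
  states 0 and 1, and \<open>p0\<close> and \<open>p1\<close> are the reference probabilities of choosing to move to state 0.
\<close>

text \<open>The convention \<open>0 log 0 = 0\<close> is automatic: the factor 0 annihilates \<^term>\<open>ln 0 :: real\<close>.\<close>

definition bin_entropy :: "real \<Rightarrow> real" where
  "bin_entropy a = - a * ln a - (1 - a) * ln (1 - a)"

definition TV :: "real \<Rightarrow> real \<Rightarrow> real" where
  "TV p a = \<bar>a - p\<bar> + \<bar>(1 - a) - (1 - p)\<bar>"

definition disc_init :: "real \<Rightarrow> real \<Rightarrow> real" where
  "disc_init \<gamma> d = (1 - \<gamma>) * d"


subsection \<open>The linear program over occupancy measures\<close>

abbreviation unit_borel :: "real measure" where
  "unit_borel \<equiv> restrict_space borel {0..1}"

definition finite_borel_on_unit :: "real measure \<Rightarrow> bool" where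
  "finite_borel_on_unit \<mu> \<longleftrightarrow> finite_measure \<mu> \<and> sets \<mu> = sets unit_borel"

definition P1_objective :: "real measure \<Rightarrow> real measure \<Rightarrow> real" where
  "P1_objective \<mu>0 \<mu>1 = (\<integral>a. bin_entropy a \<partial>\<mu>0) + (\<integral>a. bin_entropy a \<partial>\<mu>1)"

definition P1_feasible ::
  "real \<Rightarrow> real \<Rightarrow> real \<Rightarrow> real \<Rightarrow> real \<Rightarrow> real \<Rightarrow> real measure \<Rightarrow> real measure \<Rightarrow> bool" where
  "P1_feasible \<gamma> d0 d1 p0 p1 b \<mu>0 \<mu>1 \<longleftrightarrow>
     finite_borel_on_unit \<mu>0 \<and> finite_borel_on_unit \<mu>1 \<and>
     (\<integral>a. 1 \<partial>\<mu>0) - ((\<integral>a. \<gamma> * a \<partial>\<mu>0) + (\<integral>a. \<gamma> * a \<partial>\<mu>1)) = disc_init \<gamma> d0 \<and>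
     (\<integral>a. 1 \<partial>\<mu>1) - ((\<integral>a. \<gamma> * (1 - a) \<partial>\<mu>0) + (\<integral>a. \<gamma> * (1 - a) \<partial>\<mu>1)) = disc_init \<gamma> d1 \<and>
     (\<integral>a. TV p0 a \<partial>\<mu>0) + (\<integral>a. TV p1 a \<partial>\<mu>1) \<le> b"

definition P1_optimal ::
  "real \<Rightarrow> real \<Rightarrow> real \<Rightarrow> real \<Rightarrow> real \<Rightarrow> real \<Rightarrow> real measure \<Rightarrow> real measure \<Rightarrow> bool" where
  "P1_optimal \<gamma> d0 d1 p0 p1 b \<mu>0 \<mu>1 \<longleftrightarrow>
     P1_feasible \<gamma> d0 d1 p0 p1 b \<mu>0 \<mu>1 \<and>
     (\<forall>\<nu>0 \<nu>1. P1_feasible \<gamma> d0 d1 p0 p1 b \<nu>0 \<nu>1 \<longrightarrow> P1_objective \<nu>0 \<nu>1 \<le> P1_objective \<mu>0 \<mu>1)"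


subsection \<open>Deterministic stationary policies\<close>

definition occ0 :: "real \<Rightarrow> real \<Rightarrow> real \<Rightarrow> real \<Rightarrow> real" where
  "occ0 \<gamma> d0 a0 a1 = (disc_init \<gamma> d0 + \<gamma> * a1) / (1 - \<gamma> * a0 + \<gamma> * a1)"

definition occ1 :: "real \<Rightarrow> real \<Rightarrow> real \<Rightarrow> real \<Rightarrow> real" where
  "occ1 \<gamma> d0 a0 a1 = (1 - \<gamma> * a0 - disc_init \<gamma> d0) / (1 - \<gamma> * a0 + \<gamma> * a1)"

definition optimal_policy ::
  "real \<Rightarrow> real \<Rightarrow> real \<Rightarrow> real \<Rightarrow> real \<Rightarrow> real \<Rightarrow> real \<Rightarrow> real \<Rightarrow> bool" where
  "optimal_policy \<gamma> d0 d1 p0 p1 b a0 a1 \<longleftrightarrow>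
     a0 \<in> {0..1} \<and> a1 \<in> {0..1} \<and>
     P1_optimal \<gamma> d0 d1 p0 p1 b
       (scale_measure (ennreal (occ0 \<gamma> d0 a0 a1)) (return unit_borel a0))
       (scale_measure (ennreal (occ1 \<gamma> d0 a0 a1)) (return unit_borel a1))"


subsection \<open>The functions and thresholds describing the solution\<close>

definition Phi :: "real \<Rightarrow> real \<Rightarrow> real \<Rightarrow> real \<Rightarrow> real \<Rightarrow> real" where
  "Phi \<sigma> \<gamma> p0 p1 a = (\<sigma> + \<gamma> * p0 + \<gamma> * p1) * ln ((1 - a) / a) - 2 * \<gamma> * ln (1 - a)"

text \<open>
  \<open>Phi_plus\<close> is only used on \<open>[0, 1/2]\<close> and \<open>Phi_minus\<close> only on \<open>[1/2, 1]\<close>; at the singular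
  endpoint of its interval each takes its limiting value.
\<close>

definition Phi_plus :: "real \<Rightarrow> real \<Rightarrow> real \<Rightarrow> real \<Rightarrow> ereal" where
  "Phi_plus \<gamma> p0 p1 a = (if a = 0 then \<infinity> else ereal (Phi 1 \<gamma> p0 p1 a))"

definition Phi_minus :: "real \<Rightarrow> real \<Rightarrow> real \<Rightarrow> real \<Rightarrow> ereal" where
  "Phi_minus \<gamma> p0 p1 a = (if a = 1 then \<infinity> else ereal (Phi (- 1) \<gamma> p0 p1 a))"

definition psi0 :: "real \<Rightarrow> real \<Rightarrow> real \<Rightarrow> real" where
  "psi0 \<gamma> p0 p1 = (THE a. a \<in> {0..1/2} \<and> Phi_plus \<gamma> p0 p1 a = Phi_minus \<gamma> p0 p1 p1)"

definition psi1 :: "real \<Rightarrow> real \<Rightarrow> real \<Rightarrow> real" where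
  "psi1 \<gamma> p0 p1 = (THE a. a \<in> {1/2..1} \<and> Phi_minus \<gamma> p0 p1 a = Phi_plus \<gamma> p0 p1 p0)"

text \<open>
  The value at 0 is immaterial: the step is only evaluated at 0 when \<open>p0 + p1 = 1\<close>, where
  \<open>psi0 = p0\<close> and \<open>psi1 = p1\<close>.
\<close>

definition unit_step :: "real \<Rightarrow> real" where
  "unit_step x = (if x > 0 then 1 else 0)"

definition b_low :: "real \<Rightarrow> real \<Rightarrow> real \<Rightarrow> real \<Rightarrow> real" where
  "b_low \<gamma> d0 p0 p1 =
     2 * ((disc_init \<gamma> d0 + \<gamma> * p1) / (1 - \<gamma> * psi0 \<gamma> p0 p1 + \<gamma> * p1))
       * (psi0 \<gamma> p0 p1 - p0) * unit_step (1 - p0 - p1)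
   + 2 * ((1 - \<gamma> * p0 - disc_init \<gamma> d0) / (1 - \<gamma> * p0 + \<gamma> * psi1 \<gamma> p0 p1))
       * (p1 - psi1 \<gamma> p0 p1) * unit_step (- 1 + p0 + p1)"

definition b_high :: "real \<Rightarrow> real \<Rightarrow> real \<Rightarrow> real \<Rightarrow> real" where
  "b_high \<gamma> d0 p0 p1 = (2 * disc_init \<gamma> d0 + \<gamma>) * (1 - p0 - p1) + 2 * p1 - 1"

definition eta0_plus :: "real \<Rightarrow> real \<Rightarrow> real \<Rightarrow> real \<Rightarrow> real \<Rightarrow> real" where
  "eta0_plus \<gamma> d0 p0 p1 b =
     (b / 2 * (1 + \<gamma> * p1) + p0 * (disc_init \<gamma> d0 + \<gamma> * p1))
     / ((\<gamma> * p1 + disc_init \<gamma> d0) + \<gamma> * (b / 2))"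

definition eta1_minus :: "real \<Rightarrow> real \<Rightarrow> real \<Rightarrow> real \<Rightarrow> real \<Rightarrow> real" where
  "eta1_minus \<gamma> d0 p0 p1 b =
     (b / 2 * (1 - \<gamma> * p0) - p1 * (1 - \<gamma> * p0 - disc_init \<gamma> d0))
     / (- (1 - \<gamma> * p0 - disc_init \<gamma> d0) - \<gamma> * (b / 2))"

definition m_cost :: "real \<Rightarrow> real \<Rightarrow> real \<Rightarrow> real \<Rightarrow> real \<Rightarrow> real \<Rightarrow> real" where
  "m_cost \<gamma> d0 p0 p1 a0 a1 = occ0 \<gamma> d0 a0 a1 * (a0 - p0) + occ1 \<gamma> d0 a0 a1 * (p1 - a1)"

definition S_set :: "real \<Rightarrow> real \<Rightarrow> real \<Rightarrow> real \<Rightarrow> real \<Rightarrow> (real \<times> real) set" where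
  "S_set \<gamma> d0 p0 p1 b =
     {(a0, a1). a0 \<in> {p0..1/2} \<and> a1 \<in> {1/2..p1} \<and>
        Phi_minus \<gamma> p0 p1 a1 = Phi_plus \<gamma> p0 p1 a0 \<and>
        m_cost \<gamma> d0 p0 p1 a0 a1 = b / 2}"

end

theory Submission
  imports Defs
begin

text \<open>
  The problem is a linear program, so optimality of a policy follows from a dual solution: multipliers
  for which the Lagrangian \<open>H(a) - \<beta> TV\<^sub>s(a) + \<gamma> l a\<close> is maximal at \<open>a\<^sub>s\<close> in both states, with maximal
  values differing by \<open>l\<close>. The Lagrangians are concave, so maximality is a subgradient condition. When
  both actions lie off the kinks of \<open>TV\<^sub>s\<close>, eliminating the multipliers leaves the balance equation
  between \<open>\<Phi>\<^sub>+\<close> and \<open>\<Phi>\<^sub>-\<close>; when one action sits at its kink only an inequality between them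
  remains, which is what holds for budgets below \<open>b_low\<close>. Exchanging the two states and replacing
  \<open>a\<close> by \<open>1 - a\<close> maps \<open>p\<^sub>0 + p\<^sub>1\<close> to \<open>2 - p\<^sub>0 - p\<^sub>1\<close>, so only one of the two low-budget cases has to be
  treated.
\<close>

section \<open>Entropy and total variation\<close>

text \<open>Gibbs' inequality. The right-hand side is affine in \<open>a\<close> and touches the
  entropy at \<open>q\<close>, so it is the tangent line there; all concavity used below comes from
  this bound.\<close>

lemma bin_entropy_le_cross:
  assumes a: "a \<in> {0..1}" and q: "0 < q" "q < 1"
  shows "bin_entropy a \<le> - a * ln q - (1 - a) * ln (1 - q)"
proof -
  \<comment> \<open>This is \<open>ln z \<le> z - 1\<close> at \<open>z = y / x\<close>. The
    corrections \<open>y - x\<close> cancel when the pairs \<open>(a, q)\<close> and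
    \<open>(1 - a, 1 - q)\<close> are added.\<close>
  have *: "- x * ln x \<le> - x * ln y + (y - x)" if "0 \<le> x" "0 < y" for x y :: real
  proof (cases "x = 0")
    case False
    then have x: "0 < x" using that by simp
    have "x * ln (y / x) \<le> x * (y / x - 1)"
      using x that by (intro mult_left_mono ln_le_minus_one) auto
    also have "\<dots> = y - x" using x by (simp add: field_simps)
    finally show ?thesis using x that by (simp add: ln_div algebra_simps)
  qed (use that in simp)
  show ?thesis
    using *[of a q] *[of "1 - a" "1 - q"] a q by (simp add: bin_entropy_def algebra_simps)
qed

lemma bin_entropy_nonneg:
  assumes "a \<in> {0..1}"
  shows "0 \<le> bin_entropy a"
proof -
  have *: "0 \<le> - x * ln x" if "0 \<le> x" "x \<le> 1" for x :: real
    using that by (cases "x = 0") (auto simp: mult_nonneg_nonpos)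
  show ?thesis using *[of a] *[of "1 - a"] assms by (simp add: bin_entropy_def algebra_simps)
qed

lemma bin_entropy_le_ln2:
  assumes "a \<in> {0..1}"
  shows "bin_entropy a \<le> ln 2"
  using bin_entropy_le_cross[OF assms, of "1/2"] by (simp add: ln_div algebra_simps)

lemma bin_entropy_half: "bin_entropy (1/2) = ln 2"
  by (simp add: bin_entropy_def ln_div)

lemma bin_entropy_reflect: "bin_entropy (1 - a) = bin_entropy a"
  by (simp add: bin_entropy_def algebra_simps)

lemma borel_measurable_bin_entropy [measurable]: "bin_entropy \<in> borel_measurable borel"
  unfolding bin_entropy_def[abs_def] by measurable

lemma TV_eq: "TV p a = 2 * \<bar>a - p\<bar>"
  by (simp add: TV_def)

lemma borel_measurable_TV [measurable]: "TV p \<in> borel_measurable borel"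
  unfolding TV_def[abs_def] by measurable

section \<open>Integration against finite measures on the unit interval\<close>

lemma finite_borel_on_unit_D:
  assumes "finite_borel_on_unit \<mu>"
  shows "finite_measure \<mu>" "space \<mu> = {0..1}"
    "f \<in> borel_measurable borel \<Longrightarrow> f \<in> borel_measurable \<mu>"
proof -
  show "finite_measure \<mu>" using assms by (simp add: finite_borel_on_unit_def)
  have s: "sets \<mu> = sets unit_borel" using assms by (simp add: finite_borel_on_unit_def)
  show "space \<mu> = {0..1}" using sets_eq_imp_space_eq[OF s] by (simp add: space_restrict_space)
  show "f \<in> borel_measurable \<mu>" if "f \<in> borel_measurable borel"
    using that measurable_cong_sets[OF s refl] measurable_restrict_space1 by blast
qed

lemma integrable_unit:
  fixes f :: "real \<Rightarrow> real"
  assumes "finite_borel_on_unit \<mu>" "f \<in> borel_measurable borel"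
    "\<And>a. a \<in> {0..1} \<Longrightarrow> \<bar>f a\<bar> \<le> K"
  shows "integrable \<mu> f"
proof -
  interpret finite_measure \<mu> using finite_borel_on_unit_D(1)[OF assms(1)] .
  show ?thesis
    using assms finite_borel_on_unit_D(2,3)[OF assms(1)]
    by (intro integrable_const_bound[where B=K] AE_I2) auto
qed

lemma integrable_unit_basic:
  assumes "finite_borel_on_unit \<mu>"
  shows "integrable \<mu> bin_entropy" "integrable \<mu> (TV p)" "integrable \<mu> (\<lambda>a. a)"
    "integrable \<mu> (\<lambda>a. c :: real)"
proof -
  show "integrable \<mu> bin_entropy"
    using bin_entropy_nonneg bin_entropy_le_ln2
    by (intro integrable_unit[OF assms, of _ "ln 2"]) (auto simp: abs_le_iff)
  show "integrable \<mu> (TV p)"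
    by (intro integrable_unit[OF assms, of _ "2 * (1 + \<bar>p\<bar>)"]) (auto simp: TV_eq abs_real_def)
  show "integrable \<mu> (\<lambda>a. a)"
    by (intro integrable_unit[OF assms, of _ 1]) auto
  show "integrable \<mu> (\<lambda>a. c)"
    by (intro integrable_unit[OF assms, of _ "\<bar>c\<bar>"]) auto
qed

lemma scale_measure_eq_density:
  "scale_measure r M = density M (\<lambda>_. r)"
  by (rule measure_eqI) (simp_all add: emeasure_density_const)

lemma finite_borel_on_unit_dirac:
  assumes "a \<in> {0..1}"
  shows "finite_borel_on_unit (scale_measure (ennreal r) (return unit_borel a))"
  unfolding finite_borel_on_unit_def
  using prob_space.emeasure_space_1[OF prob_space_return, of a unit_borel] assms
  by (auto intro!: finite_measureI simp: space_scale_measure ennreal_mult_eq_top_iff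
      space_restrict_space)

lemma integral_dirac:
  fixes f :: "real \<Rightarrow> real"
  assumes "a \<in> {0..1}" "0 \<le> r" "f \<in> borel_measurable borel"
  shows "(\<integral>x. f x \<partial>scale_measure (ennreal r) (return unit_borel a)) = r * f a"
proof -
  have [measurable]: "f \<in> borel_measurable unit_borel"
    using assms by (simp add: measurable_restrict_space1)
  have f: "f \<in> borel_measurable (return unit_borel a)" by simp
  have "(\<integral>x. f x \<partial>scale_measure (ennreal r) (return unit_borel a))
      = (\<integral>x. r *\<^sub>R f x \<partial>return unit_borel a)"
    unfolding scale_measure_eq_density
    by (rule integral_density[OF f]) (use assms in auto)
  also have "\<dots> = r * f a"
    using assms by (subst integral_return) (auto simp: space_restrict_space)
  finally show ?thesis .
qed

section \<open>Feasibility through masses and first moments\<close>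

text \<open>The two flow equations add up to \<open>(1 - \<gamma>) * (total mass - 1) = 0\<close>.
  As \<open>\<gamma> < 1\<close>, the second one can therefore be traded for total mass one.\<close>

lemma feasible_iff_moments:
  assumes g: "0 \<le> \<gamma>" "\<gamma> < 1" and d: "d0 + d1 = 1"
    and fin: "finite_borel_on_unit \<mu>0" "finite_borel_on_unit \<mu>1"
  shows "P1_feasible \<gamma> d0 d1 p0 p1 b \<mu>0 \<mu>1 \<longleftrightarrow>
    (\<integral>a. 1 \<partial>\<mu>0) + (\<integral>a. 1 \<partial>\<mu>1) = (1 :: real) \<and>
    (\<integral>a. 1 \<partial>\<mu>0) - \<gamma> * ((\<integral>a. a \<partial>\<mu>0) + (\<integral>a. a \<partial>\<mu>1)) = disc_init \<gamma> d0 \<and>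
    (\<integral>a. TV p0 a \<partial>\<mu>0) + (\<integral>a. TV p1 a \<partial>\<mu>1) \<le> b"
proof -
  have c: "(\<integral>a. \<gamma> * (1 - a) \<partial>\<mu>) = \<gamma> * ((\<integral>a. 1 \<partial>\<mu>) - (\<integral>a. a \<partial>\<mu>))"
    if "finite_borel_on_unit \<mu>" for \<mu>
    using integrable_unit_basic[OF that] by simp
  define m0 :: real where "m0 = (\<integral>a. 1 \<partial>\<mu>0)"
  define m1 :: real where "m1 = (\<integral>a. 1 \<partial>\<mu>1)"
  define x0 :: real where "x0 = (\<integral>a. a \<partial>\<mu>0)"
  define x1 :: real where "x1 = (\<integral>a. a \<partial>\<mu>1)"
  have d1: "disc_init \<gamma> d1 = 1 - \<gamma> - disc_init \<gamma> d0"
    using d by (simp add: disc_init_def algebra_simps flip: distrib_left)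
  have "m0 + m1 = 1" if "m0 - (\<gamma> * x0 + \<gamma> * x1) = disc_init \<gamma> d0"
    "m1 - (\<gamma> * (m0 - x0) + \<gamma> * (m1 - x1)) = disc_init \<gamma> d1"
  proof -
    have "(1 - \<gamma>) * (m0 + m1 - 1) = 0" using that d1 by (simp add: algebra_simps)
    then show ?thesis using g by simp
  qed
  moreover have "m1 - (\<gamma> * (m0 - x0) + \<gamma> * (m1 - x1)) = disc_init \<gamma> d1"
    if "m0 - (\<gamma> * x0 + \<gamma> * x1) = disc_init \<gamma> d0" "m0 + m1 = 1"
  proof -
    have "m1 - (\<gamma> * (m0 - x0) + \<gamma> * (m1 - x1)) = m1 - \<gamma> * (m0 + m1) + (\<gamma> * x0 + \<gamma> * x1)"
      by (simp add: algebra_simps)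
    then show ?thesis using that d1 by simp
  qed
  ultimately show ?thesis
    using fin unfolding P1_feasible_def c[OF fin(1)] c[OF fin(2)]
    unfolding integral_mult_right_zero
      m0_def[symmetric] m1_def[symmetric] x0_def[symmetric] x1_def[symmetric] distrib_left
    by blast
qed

lemma occ_nonneg:
  assumes "0 \<le> \<gamma>" "\<gamma> < 1" "0 \<le> d0" "0 \<le> d1" "d0 + d1 = 1" "a0 \<in> {0..1}" "a1 \<in> {0..1}"
  shows "0 < 1 - \<gamma> * a0 + \<gamma> * a1" "0 \<le> occ0 \<gamma> d0 a0 a1" "0 \<le> occ1 \<gamma> d0 a0 a1"
    "occ0 \<gamma> d0 a0 a1 + occ1 \<gamma> d0 a0 a1 = 1"
    "occ0 \<gamma> d0 a0 a1 - \<gamma> * (occ0 \<gamma> d0 a0 a1 * a0 + occ1 \<gamma> d0 a0 a1 * a1) = disc_init \<gamma> d0"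
proof -
  have g0: "\<gamma> * a0 \<le> \<gamma> * 1" using assms by (intro mult_left_mono) auto
  have g1: "0 \<le> \<gamma> * a1" using assms by auto
  show pos: "0 < 1 - \<gamma> * a0 + \<gamma> * a1" using g0 g1 assms by linarith
  have "(1 - \<gamma>) * d0 \<le> (1 - \<gamma>) * 1" using assms by (intro mult_left_mono) auto
  then have dd: "0 \<le> disc_init \<gamma> d0" "disc_init \<gamma> d0 \<le> 1 - \<gamma>"
    using assms by (auto simp: disc_init_def)
  show "0 \<le> occ0 \<gamma> d0 a0 a1" "0 \<le> occ1 \<gamma> d0 a0 a1"
    using pos g0 g1 dd unfolding occ0_def occ1_def by auto
  show "occ0 \<gamma> d0 a0 a1 + occ1 \<gamma> d0 a0 a1 = 1"
    using pos unfolding occ0_def occ1_def by (simp flip: add_divide_distrib)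
  define D where "D = disc_init \<gamma> d0"
  show "occ0 \<gamma> d0 a0 a1 - \<gamma> * (occ0 \<gamma> d0 a0 a1 * a0 + occ1 \<gamma> d0 a0 a1 * a1) = disc_init \<gamma> d0"
    using pos unfolding occ0_def occ1_def D_def[symmetric]
    by (simp add: divide_simps) (simp add: algebra_simps)
qed

abbreviation policy_cost :: "real \<Rightarrow> real \<Rightarrow> real \<Rightarrow> real \<Rightarrow> real \<Rightarrow> real \<Rightarrow> real" where
  "policy_cost \<gamma> d0 p0 p1 a0 a1 \<equiv>
     2 * (occ0 \<gamma> d0 a0 a1 * \<bar>a0 - p0\<bar> + occ1 \<gamma> d0 a0 a1 * \<bar>a1 - p1\<bar>)"

lemma policy_feasible:
  assumes "0 \<le> \<gamma>" "\<gamma> < 1" "0 \<le> d0" "0 \<le> d1" "d0 + d1 = 1" "a0 \<in> {0..1}" "a1 \<in> {0..1}"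
    and "policy_cost \<gamma> d0 p0 p1 a0 a1 \<le> b"
  defines "\<mu>0 \<equiv> scale_measure (ennreal (occ0 \<gamma> d0 a0 a1)) (return unit_borel a0)"
    and "\<mu>1 \<equiv> scale_measure (ennreal (occ1 \<gamma> d0 a0 a1)) (return unit_borel a1)"
  shows "P1_feasible \<gamma> d0 d1 p0 p1 b \<mu>0 \<mu>1"
    "P1_objective \<mu>0 \<mu>1 = occ0 \<gamma> d0 a0 a1 * bin_entropy a0 + occ1 \<gamma> d0 a0 a1 * bin_entropy a1"
proof -
  note occ = occ_nonneg[OF assms(1-7)]
  have i: "(\<integral>x. f x \<partial>\<mu>0) = occ0 \<gamma> d0 a0 a1 * f a0" "(\<integral>x. f x \<partial>\<mu>1) = occ1 \<gamma> d0 a0 a1 * f a1"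
    if "f \<in> borel_measurable borel" for f :: "real \<Rightarrow> real"
    unfolding \<mu>0_def \<mu>1_def using assms occ that by (auto intro: integral_dirac)
  have fin: "finite_borel_on_unit \<mu>0" "finite_borel_on_unit \<mu>1"
    unfolding \<mu>0_def \<mu>1_def using assms by (auto intro: finite_borel_on_unit_dirac)
  show "P1_objective \<mu>0 \<mu>1 = occ0 \<gamma> d0 a0 a1 * bin_entropy a0 + occ1 \<gamma> d0 a0 a1 * bin_entropy a1"
    by (simp add: P1_objective_def i)
  show "P1_feasible \<gamma> d0 d1 p0 p1 b \<mu>0 \<mu>1"
    unfolding feasible_iff_moments[OF assms(1,2,5) fin]
    unfolding i[OF borel_measurable_const] i[OF borel_measurable_TV] i[OF measurable_ident_sets[OF refl]]
    using occ assms by (simp add: TV_eq algebra_simps)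
qed

section \<open>Weak duality and the zero budget\<close>

text \<open>
  In the witness, \<open>v\<close> and \<open>l\<close> are the multipliers of the total mass and of the flow into
  state 0, \<open>\<beta>\<close> is the multiplier of the cost budget.
\<close>

definition dual_certificate ::
  "real \<Rightarrow> real \<Rightarrow> real \<Rightarrow> real \<Rightarrow> real \<Rightarrow> real \<Rightarrow> bool" where
  "dual_certificate \<gamma> p0 p1 a0 a1 \<beta> \<longleftrightarrow> 0 \<le> \<beta> \<and> (\<exists>v l.
     (\<forall>a\<in>{0..1}. bin_entropy a \<le> v + l - \<gamma> * l * a + \<beta> * TV p0 a) \<and>
     (\<forall>a\<in>{0..1}. bin_entropy a \<le> v - \<gamma> * l * a + \<beta> * TV p1 a) \<and>
     bin_entropy a0 = v + l - \<gamma> * l * a0 + \<beta> * TV p0 a0 \<and>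
     bin_entropy a1 = v - \<gamma> * l * a1 + \<beta> * TV p1 a1)"

text \<open>Weak duality: integrating the pointwise bounds against a feasible pair leaves only its
  moments, which the constraints bound by
  \<open>v + l * disc_init \<gamma> d0 + \<beta> * b\<close>. The policy attains this, because the
  bounds are equalities at \<open>a0\<close> and \<open>a1\<close> and the slackness condition
  holds.\<close>

lemma dual_certificate_optimal:
  assumes *: "0 \<le> \<gamma>" "\<gamma> < 1" "0 \<le> d0" "0 \<le> d1" "d0 + d1 = 1" "a0 \<in> {0..1}" "a1 \<in> {0..1}"
    and c: "policy_cost \<gamma> d0 p0 p1 a0 a1 \<le> b"
    and cert: "dual_certificate \<gamma> p0 p1 a0 a1 \<beta>"
    and slack: "\<beta> = 0 \<or> policy_cost \<gamma> d0 p0 p1 a0 a1 = b"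
  shows "optimal_policy \<gamma> d0 d1 p0 p1 b a0 a1"
  unfolding optimal_policy_def P1_optimal_def
proof (intro conjI allI impI)
  note pf = policy_feasible[OF * c]
  note occ = occ_nonneg[OF *]
  show "P1_feasible \<gamma> d0 d1 p0 p1 b
       (scale_measure (ennreal (occ0 \<gamma> d0 a0 a1)) (return unit_borel a0))
       (scale_measure (ennreal (occ1 \<gamma> d0 a0 a1)) (return unit_borel a1))"
    by (rule pf(1))
  obtain v l where b0: "0 \<le> \<beta>"
    and f0: "\<And>a. a \<in> {0..1} \<Longrightarrow> bin_entropy a \<le> v + l - \<gamma> * l * a + \<beta> * TV p0 a"
    and f1: "\<And>a. a \<in> {0..1} \<Longrightarrow> bin_entropy a \<le> v - \<gamma> * l * a + \<beta> * TV p1 a"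
    and e0: "bin_entropy a0 = v + l - \<gamma> * l * a0 + \<beta> * TV p0 a0"
    and e1: "bin_entropy a1 = v - \<gamma> * l * a1 + \<beta> * TV p1 a1"
    using cert unfolding dual_certificate_def by blast
  fix \<nu>0 \<nu>1 assume feas: "P1_feasible \<gamma> d0 d1 p0 p1 b \<nu>0 \<nu>1"
  then have fin: "finite_borel_on_unit \<nu>0" "finite_borel_on_unit \<nu>1"
    by (auto simp: P1_feasible_def)
  note mom = feas[unfolded feasible_iff_moments[OF *(1,2,5) fin]]
  \<comment> \<open>The constant \<open>c\<close> is \<open>v + l\<close> in state 0 and
    \<open>v\<close> in state 1.\<close>
  have i: "(\<integral>a. bin_entropy a \<partial>\<nu>) \<le> c * (\<integral>a. 1 \<partial>\<nu>) - \<gamma> * l * (\<integral>a. a \<partial>\<nu>) + \<beta> * (\<integral>a. TV p a \<partial>\<nu>)"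
    if \<nu>: "finite_borel_on_unit \<nu>"
      and f: "\<And>a. a \<in> {0..1} \<Longrightarrow> bin_entropy a \<le> c - \<gamma> * l * a + \<beta> * TV p a" for \<nu> c p
  proof -
    note int = integrable_unit_basic[OF \<nu>]
    have "(\<integral>a. bin_entropy a \<partial>\<nu>) \<le> (\<integral>a. c * 1 - \<gamma> * l * a + \<beta> * TV p a \<partial>\<nu>)"
      using int f finite_borel_on_unit_D(2)[OF \<nu>]
      by (intro integral_mono) auto
    also have "\<dots> = c * (\<integral>a. 1 \<partial>\<nu>) - \<gamma> * l * (\<integral>a. a \<partial>\<nu>) + \<beta> * (\<integral>a. TV p a \<partial>\<nu>)"
      using int by simp
    finally show ?thesis .
  qed
  define m0 :: real where "m0 = (\<integral>a. 1 \<partial>\<nu>0)"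
  define m1 :: real where "m1 = (\<integral>a. 1 \<partial>\<nu>1)"
  define x0 :: real where "x0 = (\<integral>a. a \<partial>\<nu>0)"
  define x1 :: real where "x1 = (\<integral>a. a \<partial>\<nu>1)"
  define t0 :: real where "t0 = (\<integral>a. TV p0 a \<partial>\<nu>0)"
  define t1 :: real where "t1 = (\<integral>a. TV p1 a \<partial>\<nu>1)"
  have mm: "m0 + m1 = 1" "m0 - \<gamma> * (x0 + x1) = disc_init \<gamma> d0" "t0 + t1 \<le> b"
    using mom by (auto simp: m0_def m1_def x0_def x1_def t0_def t1_def)
  have "P1_objective \<nu>0 \<nu>1 \<le> (v + l) * m0 - \<gamma> * l * x0 + \<beta> * t0 + (v * m1 - \<gamma> * l * x1 + \<beta> * t1)"
    unfolding P1_objective_def m0_def m1_def x0_def x1_def t0_def t1_def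
    by (intro add_mono i fin f0 f1)
  also have "\<dots> = v * (m0 + m1) + l * (m0 - \<gamma> * (x0 + x1)) + \<beta> * (t0 + t1)"
    by (simp add: algebra_simps)
  also have "\<dots> \<le> v + l * disc_init \<gamma> d0 + \<beta> * b"
    using mm b0 by (simp add: mult_left_mono)
  also have "\<beta> * b = \<beta> * policy_cost \<gamma> d0 p0 p1 a0 a1"
    using slack by auto
  also have "v + l * disc_init \<gamma> d0 + \<beta> * policy_cost \<gamma> d0 p0 p1 a0 a1
     = v * (occ0 \<gamma> d0 a0 a1 + occ1 \<gamma> d0 a0 a1) 
       + l * (occ0 \<gamma> d0 a0 a1 - \<gamma> * (occ0 \<gamma> d0 a0 a1 * a0 + occ1 \<gamma> d0 a0 a1 * a1))
       + \<beta> * policy_cost \<gamma> d0 p0 p1 a0 a1"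
    unfolding occ(4,5) by simp
  also have "\<dots> = occ0 \<gamma> d0 a0 a1 * bin_entropy a0 + occ1 \<gamma> d0 a0 a1 * bin_entropy a1"
    unfolding e0 e1 TV_eq by (simp add: algebra_simps)
  finally show "P1_objective \<nu>0 \<nu>1 \<le> P1_objective
       (scale_measure (ennreal (occ0 \<gamma> d0 a0 a1)) (return unit_borel a0))
       (scale_measure (ennreal (occ1 \<gamma> d0 a0 a1)) (return unit_borel a1))"
    unfolding pf(2) .
qed (use assms in auto)

text \<open>
  With a zero budget no multiplier need exist (the entropy has infinite slope at 0 and 1), but then
  all feasible points have the same objective.
\<close>

lemma zero_cost_objective:
  assumes *: "0 \<le> \<gamma>" "\<gamma> < 1" "0 \<le> d0" "0 \<le> d1" "d0 + d1 = 1" "p0 \<in> {0..1}" "p1 \<in> {0..1}"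
    and feas: "P1_feasible \<gamma> d0 d1 p0 p1 0 \<nu>0 \<nu>1"
  shows "P1_objective \<nu>0 \<nu>1 = occ0 \<gamma> d0 p0 p1 * bin_entropy p0 + occ1 \<gamma> d0 p0 p1 * bin_entropy p1"
proof -
  have fin: "finite_borel_on_unit \<nu>0" "finite_borel_on_unit \<nu>1"
    using feas by (auto simp: P1_feasible_def)
  note mom = feas[unfolded feasible_iff_moments[OF *(1,2,5) fin]]
  note occ = occ_nonneg[OF *]
  have TV0: "0 \<le> (\<integral>a. TV p a \<partial>\<nu>)" for p \<nu>
    by (rule Bochner_Integration.integral_nonneg) (simp add: TV_eq)
  have i: "(\<integral>a. f a \<partial>\<nu>) = f p * (\<integral>a. 1 \<partial>\<nu>)"
    if \<nu>: "finite_borel_on_unit \<nu>" and z: "(\<integral>a. TV p a \<partial>\<nu>) = 0"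
      and f: "f \<in> borel_measurable borel" for \<nu> p and f :: "real \<Rightarrow> real"
  proof -
    \<comment> \<open>A nonnegative function with integral zero vanishes almost everywhere, and
      \<open>TV p\<close> vanishes only at \<open>p\<close>; hence the measure is concentrated at
      \<open>p\<close>.\<close>
    have "AE a in \<nu>. 0 \<le> TV p a" by (simp add: TV_eq)
    then have "AE a in \<nu>. TV p a = 0"
      using integral_nonneg_eq_0_iff_AE[OF integrable_unit_basic(2)[OF \<nu>]] z by blast
    then have "AE a in \<nu>. f a = f p * 1"
      by eventually_elim (simp add: TV_eq)
    then have "(\<integral>a. f a \<partial>\<nu>) = (\<integral>a. f p * 1 \<partial>\<nu>)"
      using finite_borel_on_unit_D(3)[OF \<nu>] f by (intro integral_cong_AE) auto
    then show ?thesis using integrable_unit_basic(4)[OF \<nu>, of 1] by simp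
  qed
  have z: "(\<integral>a. TV p0 a \<partial>\<nu>0) = 0" "(\<integral>a. TV p1 a \<partial>\<nu>1) = 0"
    using mom TV0[of \<nu>0 p0] TV0[of \<nu>1 p1] by auto
  note i0 = i[OF fin(1) z(1)] and i1 = i[OF fin(2) z(2)]
  define m0 :: real where "m0 = (\<integral>a. 1 \<partial>\<nu>0)"
  define m1 :: real where "m1 = (\<integral>a. 1 \<partial>\<nu>1)"
  have m: "m0 + m1 = 1" "m0 - \<gamma> * (p0 * m0 + p1 * m1) = disc_init \<gamma> d0"
    using mom i0[of "\<lambda>a. a"] i1[of "\<lambda>a. a"] by (auto simp: m0_def m1_def)
  \<comment> \<open>With both supports fixed, the mass and flow equations form a linear system whose
    only solution is the pair of occupancies.\<close>
  have "m0 * (1 - \<gamma> * p0 + \<gamma> * p1) = m0 - \<gamma> * (p0 * m0 + p1 * m1) + \<gamma> * p1 * (m0 + m1)"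
    by (simp add: algebra_simps)
  also have "\<dots> = disc_init \<gamma> d0 + \<gamma> * p1"
    by (simp add: m)
  finally have "m0 = occ0 \<gamma> d0 p0 p1"
    using occ(1) unfolding occ0_def by (simp add: field_simps)
  moreover from this have "m1 = occ1 \<gamma> d0 p0 p1"
    using occ(4) m(1) by simp
  ultimately show ?thesis
    unfolding P1_objective_def by (simp add: i0 i1 m0_def m1_def)
qed

text \<open>The policy is itself feasible, so \<open>zero_cost_objective\<close> gives its objective
  as well as that of every competitor.\<close>

lemma zero_budget_optimal:
  assumes *: "0 \<le> \<gamma>" "\<gamma> < 1" "0 \<le> d0" "0 \<le> d1" "d0 + d1 = 1" "p0 \<in> {0..1}" "p1 \<in> {0..1}"
    and a: "a0 \<in> {0..1}" "a1 \<in> {0..1}"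
    and c: "policy_cost \<gamma> d0 p0 p1 a0 a1 \<le> 0"
  shows "optimal_policy \<gamma> d0 d1 p0 p1 0 a0 a1"
  using policy_feasible(1)[OF *(1-5) a c] zero_cost_objective[OF *] a
  by (auto simp: optimal_policy_def P1_optimal_def)

subsection \<open>Solving for the multipliers\<close>

text \<open>\<open>s0\<close> and \<open>s1\<close> are subgradients of \<open>\<beta> * TV\<close>
  at the chosen actions, and \<open>L0\<close>, \<open>L1\<close> state that the entropy slope
  matches them. Concavity turns this stationarity into the global bounds. The choice of
  \<open>v\<close> gives equality at \<open>a1\<close>, the equation for \<open>l\<close> gives it
  at \<open>a0\<close>.\<close>

lemma dual_certificateI:
  fixes p0 p1 a0 a1 \<gamma> \<beta> l s0 s1 :: real
  defines "v \<equiv> bin_entropy a1 + \<gamma> * l * a1 - \<beta> * TV p1 a1"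
  assumes a: "0 < a0" "a0 < 1" "0 < a1" "a1 < 1" and b: "0 \<le> \<beta>"
    and s0: "\<And>a. s0 * (a - a0) \<le> \<beta> * TV p0 a - \<beta> * TV p0 a0"
    and s1: "\<And>a. s1 * (a - a1) \<le> \<beta> * TV p1 a - \<beta> * TV p1 a1"
    and L0: "ln (1 - a0) - ln a0 = s0 - \<gamma> * l"
    and L1: "ln (1 - a1) - ln a1 = s1 - \<gamma> * l"
    and l: "l = (bin_entropy a0 + \<gamma> * l * a0 - \<beta> * TV p0 a0) - v"
  shows "dual_certificate \<gamma> p0 p1 a0 a1 \<beta>"
proof -
  \<comment> \<open>The cross-entropy bound rewritten as the tangent line at
    \<open>q\<close>.\<close>
  have *: "bin_entropy a \<le> bin_entropy q + (ln (1 - q) - ln q) * (a - q)"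
    if "a \<in> {0..1}" "0 < q" "q < 1" for a q :: real
    using bin_entropy_le_cross[OF that] by (simp add: bin_entropy_def algebra_simps)
  have 0: "bin_entropy a \<le> v + l - \<gamma> * l * a + \<beta> * TV p0 a" if "a \<in> {0..1}" for a
    using *[OF that a(1,2)] s0[of a] l unfolding L0 by (simp add: algebra_simps)
  have 1: "bin_entropy a \<le> v - \<gamma> * l * a + \<beta> * TV p1 a" if "a \<in> {0..1}" for a
    using *[OF that a(3,4)] s1[of a] unfolding L1 v_def by (simp add: algebra_simps)
  show ?thesis
    unfolding dual_certificate_def
    by (rule conjI[OF b], rule exI[of _ v], rule exI[of _ l]) (use 0 1 l in \<open>auto simp: v_def\<close>)
qed

lemma TV_reflect: "TV (1 - p) (1 - a) = TV p a"
  by (simp add: TV_def)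

text \<open>The two bounds change places under the substitution of \<open>1 - a\<close> for
  \<open>a\<close>.\<close>

lemma dual_certificate_reflect:
  assumes "dual_certificate \<gamma> (1 - p1) (1 - p0) (1 - a1) (1 - a0) \<beta>"
  shows "dual_certificate \<gamma> p0 p1 a0 a1 \<beta>"
proof -
  obtain v l where b0: "0 \<le> \<beta>"
    and f0: "\<And>a. a \<in> {0..1} \<Longrightarrow> bin_entropy a \<le> v + l - \<gamma> * l * a + \<beta> * TV (1 - p1) a"
    and f1: "\<And>a. a \<in> {0..1} \<Longrightarrow> bin_entropy a \<le> v - \<gamma> * l * a + \<beta> * TV (1 - p0) a"
    and e0: "bin_entropy (1 - a1) = v + l - \<gamma> * l * (1 - a1) + \<beta> * TV (1 - p1) (1 - a1)"
    and e1: "bin_entropy (1 - a0) = v - \<gamma> * l * (1 - a0) + \<beta> * TV (1 - p0) (1 - a0)"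
    using assms unfolding dual_certificate_def by blast
  show ?thesis
    unfolding dual_certificate_def
  \<comment> \<open>Expanding \<open>v + l - \<gamma> * l * (1 - a)\<close> gives the constant
    \<open>v + l - \<gamma> * l\<close> and the slope \<open>\<gamma> * l\<close>; these are the new
    \<open>v\<close> and the negated \<open>l\<close> of state 1.\<close>
  proof (rule conjI[OF b0], rule exI[of _ "v + l - \<gamma> * l"], rule exI[of _ "- l"], intro conjI ballI)
    fix a :: real assume a: "a \<in> {0..1}"
    show "bin_entropy a \<le> v + l - \<gamma> * l + - l - \<gamma> * - l * a + \<beta> * TV p0 a"
      using f1[of "1 - a"] a by (simp add: bin_entropy_reflect TV_reflect algebra_simps)
    show "bin_entropy a \<le> v + l - \<gamma> * l - \<gamma> * - l * a + \<beta> * TV p1 a"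
      using f0[of "1 - a"] a by (simp add: bin_entropy_reflect TV_reflect algebra_simps)
  qed (use b0 e0 e1 in \<open>auto simp: bin_entropy_reflect TV_reflect algebra_simps\<close>)
qed

text \<open>
  Stationarity of \<open>bin_entropy a - \<beta> * TV p a + \<gamma> * l * a\<close> in both states determines
  \<open>\<beta>\<close> and \<open>l\<close>; the definition of \<open>l\<close> then becomes exactly the balance equation on \<open>Phi\<close>.
\<close>

lemma dual_certificate_balanced:
  assumes a: "0 < a0" "p0 \<le> a0" "a0 \<le> 1/2" "1/2 \<le> a1" "a1 \<le> p1" "a1 < 1"
    and Phi: "Phi 1 \<gamma> p0 p1 a0 = Phi (- 1) \<gamma> p0 p1 a1"
  shows "\<exists>\<beta>. dual_certificate \<gamma> p0 p1 a0 a1 \<beta>"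
proof -
  define L0 where "L0 = ln (1 - a0) - ln a0"
  define L1 where "L1 = ln (1 - a1) - ln a1"
  \<comment> \<open>Stationarity reads \<open>L0 = 2 * \<beta> - \<gamma> * l\<close> and
    \<open>L1 = - 2 * \<beta> - \<gamma> * l\<close>. Their difference gives \<open>\<beta>\<close>;
    inserting them into the equation of values removes the terms in \<open>a0\<close> and
    \<open>a1\<close> outside the logarithms and gives \<open>l\<close>.\<close>
  define \<beta> where "\<beta> = (L0 - L1) / 4"
  define l where "l = ln (1 - a1) - ln (1 - a0) + 2 * \<beta> * (p0 + p1)"
  have L: "0 \<le> L0" "L1 \<le> 0" using a by (auto simp: L0_def L1_def)
  have ln0: "ln ((1 - a0) / a0) = L0" and ln1: "ln ((1 - a1) / a1) = L1"
    using a by (auto simp: L0_def L1_def ln_div)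
  \<comment> \<open>The sum of the two stationarity equations; this is where the balance of
    \<open>Phi\<close> enters.\<close>
  have gl: "\<gamma> * l = - (L0 + L1) / 2"
    using Phi unfolding Phi_def ln0 ln1 l_def \<beta>_def by (simp add: field_simps)
  have b: "0 \<le> \<beta>" using L by (simp add: \<beta>_def)
  have TV0: "TV p0 a0 = 2 * (a0 - p0)" and TV1: "TV p1 a1 = 2 * (p1 - a1)"
    using a by (auto simp: TV_eq)
  have "dual_certificate \<gamma> p0 p1 a0 a1 \<beta>"
  proof (rule dual_certificateI[where l = l and ?s0.0 = "2 * \<beta>" and ?s1.0 = "- 2 * \<beta>"])
    fix a
    have "a - a0 \<le> \<bar>a - p0\<bar> - (a0 - p0)" "a1 - a \<le> \<bar>a - p1\<bar> - (p1 - a1)"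
      by linarith+
    from this[THEN mult_left_mono, of "2 * \<beta>"] b
    show "2 * \<beta> * (a - a0) \<le> \<beta> * TV p0 a - \<beta> * TV p0 a0"
      "- 2 * \<beta> * (a - a1) \<le> \<beta> * TV p1 a - \<beta> * TV p1 a1"
      unfolding TV0 TV1 unfolding TV_eq by (simp_all add: algebra_simps)
  next
    have h0: "bin_entropy a0 = a0 * L0 - ln (1 - a0)" and h1: "bin_entropy a1 = a1 * L1 - ln (1 - a1)"
      by (simp_all add: bin_entropy_def L0_def L1_def algebra_simps)
    show "l = (bin_entropy a0 + \<gamma> * l * a0 - \<beta> * TV p0 a0)
       - (bin_entropy a1 + \<gamma> * l * a1 - \<beta> * TV p1 a1)"
      unfolding h0 h1 TV0 TV1 gl by (simp add: l_def \<beta>_def field_simps)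
  qed (use a b gl in \<open>auto simp: L0_def L1_def \<beta>_def field_simps\<close>)
  then show ?thesis by blast
qed

text \<open>At the kink \<open>p1\<close> every slope in \<open>[- 2 * \<beta>, 2 * \<beta>]\<close>
  is a subgradient, so stationarity in state 1 relaxes to
  \<open>\<bar>L1 + \<gamma> * l\<bar> \<le> 2 * \<beta>\<close>. One side follows from the signs of
  \<open>L0\<close> and \<open>L1\<close>, the other is the inequality on
  \<open>Phi\<close>.\<close>

lemma dual_certificate_corner:
  assumes g: "0 \<le> \<gamma>" and a: "0 < a0" "p0 \<le> a0" "a0 \<le> 1/2" "1/2 \<le> p1" "p1 < 1"
    and Phi: "Phi (- 1) \<gamma> p0 p1 p1 \<le> Phi 1 \<gamma> p0 p1 a0"
  shows "\<exists>\<beta>. dual_certificate \<gamma> p0 p1 a0 p1 \<beta>"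
proof -
  define L0 where "L0 = ln (1 - a0) - ln a0"
  define L1 where "L1 = ln (1 - p1) - ln p1"
  \<comment> \<open>Stationarity in state 0 gives \<open>2 * \<beta> = L0 + \<gamma> * l\<close>.
    The equation of values is then linear in \<open>l\<close>, with coefficient
    \<open>k\<close>.\<close>
  define k where "k = 1 + \<gamma> * (p1 - p0)"
  define l where "l = (p0 * L0 - p1 * L1 - ln (1 - a0) + ln (1 - p1)) / k"
  define \<beta> where "\<beta> = (L0 + \<gamma> * l) / 2"
  have "0 \<le> \<gamma> * (p1 - p0)" using g a by (intro mult_nonneg_nonneg) auto
  then have k: "0 < k" by (simp add: k_def)
  have L: "0 \<le> L0" "L1 \<le> 0" using a by (auto simp: L0_def L1_def)
  have ln0: "ln ((1 - a0) / a0) = L0" and ln1: "ln ((1 - p1) / p1) = L1"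
    using a by (auto simp: L0_def L1_def ln_div)
  have kl: "k * l = p0 * L0 - p1 * L1 - ln (1 - a0) + ln (1 - p1)"
    using k by (simp add: l_def)
  have "k * (L0 + L1 + 2 * \<gamma> * l) = k * (L0 + L1) + 2 * \<gamma> * (k * l)"
    by (simp add: algebra_simps)
  also have "\<dots> = Phi 1 \<gamma> p0 p1 a0 - Phi (- 1) \<gamma> p0 p1 p1"
    unfolding Phi_def ln0 ln1 kl by (simp add: k_def algebra_simps)
  finally have "0 \<le> k * (L0 + L1 + 2 * \<gamma> * l)" using Phi by simp
  then have left: "0 \<le> L0 + L1 + 2 * \<gamma> * l" using k by (simp add: zero_le_mult_iff)
  have b: "0 \<le> \<beta>" using left L by (simp add: \<beta>_def)
  \<comment> \<open>\<open>left\<close> bounds the negative of \<open>L1 + \<gamma> * l\<close>, and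
    \<open>L1 \<le> L0\<close> bounds it from above.\<close>
  have "\<bar>L1 + \<gamma> * l\<bar> \<le> L0 + \<gamma> * l" using left[unfolded mult.assoc] L by linarith
  then have s: "\<bar>L1 + \<gamma> * l\<bar> \<le> 2 * \<beta>" by (simp add: \<beta>_def)
  have TV0: "TV p0 a0 = 2 * (a0 - p0)" and TV1: "TV p1 p1 = 0"
    using a by (auto simp: TV_eq)
  have "dual_certificate \<gamma> p0 p1 a0 p1 \<beta>"
  proof (rule dual_certificateI[where l = l and ?s0.0 = "2 * \<beta>" and ?s1.0 = "L1 + \<gamma> * l"])
    fix a
    have "a - a0 \<le> \<bar>a - p0\<bar> - (a0 - p0)" by linarith
    from this[THEN mult_left_mono, of "2 * \<beta>"] b
    show "2 * \<beta> * (a - a0) \<le> \<beta> * TV p0 a - \<beta> * TV p0 a0"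
      unfolding TV0 unfolding TV_eq by (simp add: algebra_simps)
    have "(L1 + \<gamma> * l) * (a - p1) \<le> \<bar>L1 + \<gamma> * l\<bar> * \<bar>a - p1\<bar>"
      by (metis abs_ge_self abs_mult)
    also have "\<dots> \<le> 2 * \<beta> * \<bar>a - p1\<bar>" using s by (intro mult_right_mono) auto
    finally show "(L1 + \<gamma> * l) * (a - p1) \<le> \<beta> * TV p1 a - \<beta> * TV p1 p1"
      by (simp add: TV_eq)
  next
    have h0: "bin_entropy a0 = a0 * L0 - ln (1 - a0)" and h1: "bin_entropy p1 = p1 * L1 - ln (1 - p1)"
      by (simp_all add: bin_entropy_def L0_def L1_def algebra_simps)
    show "l = (bin_entropy a0 + \<gamma> * l * a0 - \<beta> * TV p0 a0)
       - (bin_entropy p1 + \<gamma> * l * p1 - \<beta> * TV p1 p1)"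
      unfolding h0 h1 TV0 TV1 using kl by (simp add: k_def \<beta>_def field_simps)
  qed (use a b in \<open>auto simp: L0_def L1_def \<beta>_def field_simps\<close>)
  then show ?thesis by blast
qed

subsection \<open>The balance functions\<close>

text \<open>
  Working with \<open>exp (- Phi)\<close> removes the infinite endpoint values: it extends continuously by 0.
  Reflecting \<open>a\<close> to \<open>1 - a\<close> turns \<open>Phi (- 1)\<close> with parameter \<open>c = p0 + p1\<close> into \<open>Phi 1\<close>
  with parameter \<open>2 - c\<close>.
\<close>

definition exp_Phi :: "real \<Rightarrow> real \<Rightarrow> real \<Rightarrow> real" where
  "exp_Phi \<gamma> c a = a powr (1 + \<gamma> * c) * (1 - a) powr (2 * \<gamma> - 1 - \<gamma> * c)"

lemma exp_Phi_plus:
  assumes "0 < a" "a < 1"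
  shows "exp_Phi \<gamma> (p0 + p1) a = exp (- Phi 1 \<gamma> p0 p1 a)"
  using assms by (simp add: exp_Phi_def Phi_def powr_def ln_div algebra_simps flip: exp_add)

lemma exp_Phi_minus:
  assumes "0 < a" "a < 1"
  shows "exp_Phi \<gamma> (2 - p0 - p1) (1 - a) = exp (- Phi (- 1) \<gamma> p0 p1 a)"
  using assms by (simp add: exp_Phi_def Phi_def powr_def ln_div algebra_simps flip: exp_add)

lemma exp_Phi_0 [simp]: "exp_Phi \<gamma> c 0 = 0"
  by (simp add: exp_Phi_def)

lemma exp_Phi_half: "exp_Phi \<gamma> c (1/2) = (1/2) powr (2 * \<gamma>)"
  by (simp add: exp_Phi_def flip: powr_add)

lemma exp_Phi_nonneg: "0 \<le> exp_Phi \<gamma> c a"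
  by (simp add: exp_Phi_def)

lemma exp_Phi_pos: "0 < a \<Longrightarrow> a < 1 \<Longrightarrow> 0 < exp_Phi \<gamma> c a"
  by (simp add: exp_Phi_def)

text \<open>The limiting value infinity of \<open>Phi_plus\<close> and \<open>Phi_minus\<close>
  corresponds to a zero of \<open>exp_Phi\<close>, which is positive in the interior; so the
  equivalence includes the endpoints.\<close>

lemma Phi_balance_iff:
  assumes "a0 \<in> {0..1/2}" "a1 \<in> {1/2..1}"
  shows "Phi_minus \<gamma> p0 p1 a1 = Phi_plus \<gamma> p0 p1 a0 \<longleftrightarrow>
    exp_Phi \<gamma> (p0 + p1) a0 = exp_Phi \<gamma> (2 - p0 - p1) (1 - a1)"
proof -
  consider "a0 = 0" | "a1 = 1" "a0 > 0" | "a1 < 1" "a0 > 0" using assms by fastforce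
  then show ?thesis
  proof cases
    case 1
    then show ?thesis
      using exp_Phi_pos[of "1 - a1" \<gamma> "2 - p0 - p1"] assms
      by (cases "a1 = 1") (auto simp: Phi_minus_def Phi_plus_def)
  next
    case 2
    then show ?thesis
      using exp_Phi_pos[of a0 \<gamma> "p0 + p1"] assms
      by (auto simp: Phi_minus_def Phi_plus_def)
  next
    case 3
    then have "exp_Phi \<gamma> (p0 + p1) a0 = exp (- Phi 1 \<gamma> p0 p1 a0)"
      "exp_Phi \<gamma> (2 - p0 - p1) (1 - a1) = exp (- Phi (- 1) \<gamma> p0 p1 a1)"
      using assms by (auto intro!: exp_Phi_plus exp_Phi_minus)
    then show ?thesis using 3 by (auto simp: Phi_minus_def Phi_plus_def)
  qed
qed

text \<open>The logarithm of \<open>exp_Phi\<close> is \<open>\<gamma> * ln (a * (1 - a))\<close>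
  plus \<open>1 + \<gamma> * (c - 1)\<close> times the logit of \<open>a\<close>. On the left half
  both functions increase, and the second coefficient is positive.\<close>

lemma exp_Phi_strict_mono:
  assumes g: "0 \<le> \<gamma>" "\<gamma> < 1" and c: "0 \<le> c" and x: "0 \<le> x" "x < y" "y \<le> 1/2"
  shows "exp_Phi \<gamma> c x < exp_Phi \<gamma> c y"
proof (cases "x = 0")
  case True
  then show ?thesis using exp_Phi_pos[of y \<gamma> c] x by simp
next
  case False
  have *: "exp_Phi \<gamma> c a = exp (\<gamma> * (ln a + ln (1 - a)) + (1 + \<gamma> * (c - 1)) * (ln a - ln (1 - a)))"
    if "0 < a" "a < 1" for a
    using that by (simp add: exp_Phi_def powr_def algebra_simps flip: exp_add)
  have e: "0 < 1 + \<gamma> * (c - 1)"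
  proof -
    have "0 \<le> \<gamma> * c" using g c by simp
    then show ?thesis using g by (simp add: algebra_simps)
  qed
  have "0 \<le> (y - x) * (1 - x - y)" using x by (intro mult_nonneg_nonneg) auto
  then have "x * (1 - x) \<le> y * (1 - y)" by (simp add: algebra_simps)
  then have "ln (x * (1 - x)) \<le> ln (y * (1 - y))"
    using False x by (subst ln_le_cancel_iff) auto
  then have "ln x + ln (1 - x) \<le> ln y + ln (1 - y)"
    using False x by (simp add: ln_mult)
  then have "\<gamma> * (ln x + ln (1 - x)) \<le> \<gamma> * (ln y + ln (1 - y))"
    using g by (intro mult_left_mono)
  moreover have "ln x - ln (1 - x) < ln y - ln (1 - y)"
  proof -
    have "ln x < ln y" "ln (1 - y) < ln (1 - x)" using False x by auto
    then show ?thesis by simp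
  qed
  then have "(1 + \<gamma> * (c - 1)) * (ln x - ln (1 - x)) < (1 + \<gamma> * (c - 1)) * (ln y - ln (1 - y))"
    using e by (intro mult_strict_left_mono)
  ultimately show ?thesis using False x by (simp add: *)
qed

lemma exp_Phi_mono_iff:
  assumes "0 \<le> \<gamma>" "\<gamma> < 1" "0 \<le> c" "x \<in> {0..1/2}" "y \<in> {0..1/2}"
  shows "exp_Phi \<gamma> c x \<le> exp_Phi \<gamma> c y \<longleftrightarrow> x \<le> y" "exp_Phi \<gamma> c x = exp_Phi \<gamma> c y \<longleftrightarrow> x = y"
  using exp_Phi_strict_mono[OF assms(1-3), of x y] exp_Phi_strict_mono[OF assms(1-3), of y x] assms(4,5)
  by - (cases x y rule: linorder_cases; simp)+

lemma continuous_on_exp_Phi: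
  assumes "0 \<le> \<gamma>" "0 \<le> c"
  shows "continuous_on {0..1/2} (exp_Phi \<gamma> c)"
proof -
  \<comment> \<open>A positive exponent makes \<open>powr\<close> continuous at base 0; the other
    base is at least 1/2.\<close>
  have "0 < 1 + \<gamma> * c" using assms by (simp add: add_pos_nonneg)
  then show ?thesis
    unfolding exp_Phi_def[abs_def] by (intro continuous_intros continuous_on_powr') auto
qed

text \<open>The value at 1/2 does not depend on \<open>c\<close>, so the inverses for
  \<open>p0 + p1\<close> and \<open>2 - p0 - p1\<close> share one domain and can parametrize a
  common curve.\<close>

lemma exp_Phi_inverse:
  assumes g: "0 \<le> \<gamma>" "\<gamma> < 1" and c: "0 \<le> c"
  obtains f where "continuous_on {0..(1/2) powr (2 * \<gamma>)} f"
    "\<And>t. t \<in> {0..(1/2) powr (2 * \<gamma>)} \<Longrightarrow> f t \<in> {0..1/2} \<and> exp_Phi \<gamma> c (f t) = t"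
proof -
  let ?S = "{0..1/2 :: real}" and ?f = "inv_into {0..1/2} (exp_Phi \<gamma> c)"
  have inj: "inj_on (exp_Phi \<gamma> c) ?S"
    using exp_Phi_mono_iff(2)[OF assms] by (auto simp: inj_on_def)
  have cont: "continuous_on ?S (exp_Phi \<gamma> c)"
    using continuous_on_exp_Phi g c by blast
  have "exp_Phi \<gamma> c x \<le> (1/2) powr (2 * \<gamma>)" if "x \<in> ?S" for x
    using exp_Phi_mono_iff(1)[OF assms that, of "1/2"] that exp_Phi_half by simp
  moreover have "\<exists>x\<in>?S. exp_Phi \<gamma> c x = t" if "t \<in> {0..(1/2) powr (2 * \<gamma>)}" for t
    using IVT'[of "exp_Phi \<gamma> c" 0 t "1/2"] that cont exp_Phi_half by force
  ultimately have im: "exp_Phi \<gamma> c ` ?S = {0..(1/2) powr (2 * \<gamma>)}"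
    using exp_Phi_nonneg by (auto simp: image_iff) metis
  have "continuous_on (exp_Phi \<gamma> c ` ?S) ?f"
    using inj cont by (intro continuous_on_inv) auto
  moreover have "?f t \<in> ?S \<and> exp_Phi \<gamma> c (?f t) = t" if "t \<in> {0..(1/2) powr (2 * \<gamma>)}" for t
    using that unfolding im[symmetric] by (metis inv_into_into f_inv_into_f)
  ultimately show thesis using that unfolding im by blast
qed

section \<open>Comparison of the two balance functions at the reference actions\<close>

text \<open>The part of \<open>exp_Phi_reflect_le\<close> with weight \<open>\<gamma>\<close>. The
  logit sum is at most \<open>- 2 * ln p\<close>, and a chord of \<open>ln\<close> handles the
  rest.\<close>

lemma logit_sum_le_ln_diff:
  fixes p q :: real
  assumes p: "0 < p" "p \<le> q" "q \<le> 1/2"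
  shows "(q - p) * (ln (1 - p) - ln p + ln (1 - q) - ln q) \<le> 2 * ln q - 2 * ln p"
proof -
  have "ln (1 - q) \<le> ln (1 - p)" "ln p \<le> ln q" "ln (1 - p) \<le> 0" using p by auto
  then have "(q - p) * (ln (1 - p) - ln p + ln (1 - q) - ln q) \<le> (q - p) * (- 2 * ln p)"
    using p by (intro mult_left_mono) linarith+
  also have "\<dots> \<le> 2 * ln q - 2 * ln p"
  proof -
    \<comment> \<open>\<open>s\<close> writes \<open>q\<close> as a convex combination of
      \<open>p\<close> and 1; concavity and \<open>ln 1 = 0\<close> then give
      \<open>(1 - s) * ln p \<le> ln q\<close>.\<close>
    define s where "s = (q - p) / (1 - p)"
    have s: "0 \<le> s" "s \<le> 1" using p by (auto simp: s_def divide_simps)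
    have "s * (1 - p) = q - p" using p by (simp add: s_def)
    then have qs: "q = (1 - s) * p + s * 1" by (simp add: algebra_simps)
    have "(1 - s) * ln p + s * ln 1 \<le> ln ((1 - s) * p + s * 1)"
      using concave_onD[OF ln_concave s, of p 1] p by simp
    then have "(1 - s) * ln p \<le> ln q" using qs by simp
    moreover have "q - p \<le> s" using p by (simp add: s_def field_simps mult_nonneg_nonneg)
    then have "(q - p) * (- ln p) \<le> s * (- ln p)" using p by (intro mult_right_mono) auto
    ultimately show ?thesis by (simp add: algebra_simps)
  qed
  finally show ?thesis .
qed

text \<open>With \<open>p = p0\<close> and \<open>q = 1 - p1\<close> the parameters become
  \<open>p0 + p1\<close> and \<open>2 - p0 - p1\<close>. The lemma thus tells which reference action
  a balanced pair reaches first. The difference of the exponents splits into parts with weights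
  \<open>1 - \<gamma>\<close> and \<open>\<gamma>\<close>.\<close>

lemma exp_Phi_reflect_le:
  assumes g: "0 \<le> \<gamma>" "\<gamma> < 1" and p: "0 \<le> p" "p \<le> q" "q \<le> 1/2"
  shows "exp_Phi \<gamma> (1 + p - q) p \<le> exp_Phi \<gamma> (1 + q - p) q"
proof (cases "p = 0")
  case False
  then have p0: "0 < p" using p by simp
  have *: "exp_Phi \<gamma> c a = exp ((1 + \<gamma> * c) * ln a + (2 * \<gamma> - 1 - \<gamma> * c) * ln (1 - a))"
    if "0 < a" "a < 1" for a c
    using that by (simp add: exp_Phi_def powr_def flip: exp_add)
  define lp lq Lp Lq where "lp = ln p" and "lq = ln q" and "Lp = ln (1 - p)" and "Lq = ln (1 - q)"
  have "lp \<le> lq" "Lq \<le> Lp" using p p0 by (auto simp: lp_def lq_def Lp_def Lq_def)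
  then have "0 \<le> (1 - \<gamma>) * (Lp - lp - Lq + lq)" using g by (intro mult_nonneg_nonneg) auto
  moreover have "0 \<le> \<gamma> * (2 * lq - 2 * lp - (q - p) * (Lp - lp + Lq - lq))"
    using logit_sum_le_ln_diff[OF p0 p(2,3)] g
    by (intro mult_nonneg_nonneg) (auto simp: lp_def lq_def Lp_def Lq_def)
  ultimately have "(1 + \<gamma> * (1 + p - q)) * lp + (2 * \<gamma> - 1 - \<gamma> * (1 + p - q)) * Lp
     \<le> (1 + \<gamma> * (1 + q - p)) * lq + (2 * \<gamma> - 1 - \<gamma> * (1 + q - p)) * Lq"
    by (simp add: algebra_simps)
  then show ?thesis using p0 p by (simp add: * lp_def lq_def Lp_def Lq_def)
qed (simp add: exp_Phi_nonneg)

section \<open>The thresholds \<open>psi0\<close> and \<open>psi1\<close>\<close>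

lemma psi0_eqI:
  assumes g: "0 \<le> \<gamma>" "\<gamma> < 1" and p: "0 \<le> p0" "p0 \<le> 1/2" "1/2 \<le> p1" "p1 \<le> 1"
    and a: "a \<in> {0..1/2}" "exp_Phi \<gamma> (p0 + p1) a = exp_Phi \<gamma> (2 - p0 - p1) (1 - p1)"
  shows "psi0 \<gamma> p0 p1 = a"
  unfolding psi0_def
proof (rule the_equality)
  have c: "0 \<le> p0 + p1" using p by simp
  have p1: "p1 \<in> {1/2..1}" using p by simp
  show "a \<in> {0..1/2} \<and> Phi_plus \<gamma> p0 p1 a = Phi_minus \<gamma> p0 p1 p1"
    using a Phi_balance_iff[OF a(1) p1, of \<gamma> p0 p1] by metis
  fix x assume x: "x \<in> {0..1/2} \<and> Phi_plus \<gamma> p0 p1 x = Phi_minus \<gamma> p0 p1 p1"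
  then have "exp_Phi \<gamma> (p0 + p1) x = exp_Phi \<gamma> (p0 + p1) a"
    using a Phi_balance_iff[OF conjunct1[OF x] p1, of \<gamma> p0 p1] by metis
  then show "x = a"
    using exp_Phi_mono_iff(2)[OF g c conjunct1[OF x] a(1)] by blast
qed

lemma psi1_eqI:
  assumes g: "0 \<le> \<gamma>" "\<gamma> < 1" and p: "0 \<le> p0" "p0 \<le> 1/2" "1/2 \<le> p1" "p1 \<le> 1"
    and a: "a \<in> {1/2..1}" "exp_Phi \<gamma> (2 - p0 - p1) (1 - a) = exp_Phi \<gamma> (p0 + p1) p0"
  shows "psi1 \<gamma> p0 p1 = a"
  unfolding psi1_def
proof (rule the_equality)
  have c: "0 \<le> 2 - p0 - p1" using p by simp
  have p0: "p0 \<in> {0..1/2}" using p by simp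
  show "a \<in> {1/2..1} \<and> Phi_minus \<gamma> p0 p1 a = Phi_plus \<gamma> p0 p1 p0"
    using a Phi_balance_iff[OF p0 a(1), of \<gamma> p0 p1] by metis
  fix x assume x: "x \<in> {1/2..1} \<and> Phi_minus \<gamma> p0 p1 x = Phi_plus \<gamma> p0 p1 p0"
  then have "exp_Phi \<gamma> (2 - p0 - p1) (1 - x) = exp_Phi \<gamma> (2 - p0 - p1) (1 - a)"
    using a Phi_balance_iff[OF p0 conjunct1[OF x], of \<gamma> p0 p1] by metis
  then show "x = a"
    using exp_Phi_mono_iff(2)[OF g c, of "1 - x" "1 - a"] x a by auto
qed

lemma psi0_props:
  assumes g: "0 \<le> \<gamma>" "\<gamma> < 1" and p: "0 \<le> p0" "p0 \<le> 1/2" "1/2 \<le> p1" "p1 \<le> 1"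
  shows "psi0 \<gamma> p0 p1 \<in> {0..1/2}"
    "exp_Phi \<gamma> (p0 + p1) (psi0 \<gamma> p0 p1) = exp_Phi \<gamma> (2 - p0 - p1) (1 - p1)"
proof -
  have c: "0 \<le> p0 + p1" "0 \<le> 2 - p0 - p1" using p by auto
  let ?K = "exp_Phi \<gamma> (2 - p0 - p1) (1 - p1)"
  have "?K \<le> exp_Phi \<gamma> (2 - p0 - p1) (1/2)"
    using exp_Phi_mono_iff(1)[OF g c(2), of "1 - p1" "1/2"] p by simp
  then have "?K \<in> {0..(1/2) powr (2 * \<gamma>)}"
    using exp_Phi_nonneg[of \<gamma> "2 - p0 - p1" "1 - p1"] by (simp add: exp_Phi_half)
  then obtain a where a: "a \<in> {0..1/2}" "exp_Phi \<gamma> (p0 + p1) a = ?K"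
    using exp_Phi_inverse[OF g c(1)] by metis
  then have "psi0 \<gamma> p0 p1 = a" using psi0_eqI[OF g p] by blast
  then show "psi0 \<gamma> p0 p1 \<in> {0..1/2}" "exp_Phi \<gamma> (p0 + p1) (psi0 \<gamma> p0 p1) = ?K"
    using a by auto
qed

text \<open>Exchanging the states swaps the two balance functions, and so transfers existence from
  \<open>psi0\<close> to \<open>psi1\<close>.\<close>

lemma psi1_eq_reflect:
  assumes g: "0 \<le> \<gamma>" "\<gamma> < 1" and p: "0 \<le> p0" "p0 \<le> 1/2" "1/2 \<le> p1" "p1 \<le> 1"
  shows "psi1 \<gamma> p0 p1 = 1 - psi0 \<gamma> (1 - p1) (1 - p0)"
proof (rule psi1_eqI[OF g p])
  have e: "(1 - p1) + (1 - p0) = 2 - p0 - p1" "2 - (1 - p1) - (1 - p0) = p0 + p1"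
    "1 - (1 - x) = x" for x :: real by simp_all
  have "psi0 \<gamma> (1 - p1) (1 - p0) \<in> {0..1/2}"
    "exp_Phi \<gamma> (2 - p0 - p1) (psi0 \<gamma> (1 - p1) (1 - p0)) = exp_Phi \<gamma> (p0 + p1) p0"
    using psi0_props[OF g, of "1 - p1" "1 - p0", unfolded e] p by simp_all
  then show "1 - psi0 \<gamma> (1 - p1) (1 - p0) \<in> {1/2..1}"
    "exp_Phi \<gamma> (2 - p0 - p1) (1 - (1 - psi0 \<gamma> (1 - p1) (1 - p0))) = exp_Phi \<gamma> (p0 + p1) p0"
    by simp_all
qed

subsection \<open>The three budget regimes\<close>

lemma occ_reflect:
  assumes "d0 + d1 = 1"
  shows "occ0 \<gamma> d1 (1 - a1) (1 - a0) = occ1 \<gamma> d0 a0 a1"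
proof -
  have d1: "d1 = 1 - d0" using assms by simp
  show ?thesis unfolding d1 by (simp add: occ0_def occ1_def disc_init_def algebra_simps)
qed

lemma eta_reflect:
  assumes d: "d0 + d1 = 1" and pos: "0 < disc_init \<gamma> d1 + \<gamma> * (1 - p0)" and "0 \<le> \<gamma>" "0 \<le> b"
  shows "eta1_minus \<gamma> d0 p0 p1 b = 1 - eta0_plus \<gamma> d1 (1 - p1) (1 - p0) b"
proof -
  define A where "A = disc_init \<gamma> d1 + \<gamma> * (1 - p0)"
  have d1: "d1 = 1 - d0" using d by simp
  have A: "1 - \<gamma> * p0 - disc_init \<gamma> d0 = A"
    unfolding A_def d1 by (simp add: disc_init_def algebra_simps)
  have A': "\<gamma> * (1 - p0) + disc_init \<gamma> d1 = A" by (simp add: A_def)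
  have "0 < A + \<gamma> * (b / 2)" using pos assms by (simp add: A_def add_pos_nonneg)
  moreover have "- A - \<gamma> * (b / 2) = - (A + \<gamma> * (b / 2))" by simp
  ultimately show ?thesis
    unfolding eta1_minus_def eta0_plus_def A A' A_def[symmetric]
    by (simp add: field_simps)
qed

text \<open>\<open>eta0_plus\<close> solves the equation that half the cost equals
  \<open>b / 2\<close> with \<open>a1 = p1\<close>. A budget below that of the policy
  \<open>(\<psi>, p1)\<close> forces \<open>a0 < \<psi>\<close>, and monotonicity of
  \<open>exp_Phi\<close> turns this into the inequality needed by
  \<open>dual_certificate_corner\<close>.\<close>

lemma corner_policy:
  fixes \<gamma> d0 d1 p0 p1 b :: real
  defines "\<psi> \<equiv> psi0 \<gamma> p0 p1" and "a0 \<equiv> eta0_plus \<gamma> d0 p0 p1 b"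
  assumes *: "0 \<le> \<gamma>" "\<gamma> < 1" "0 \<le> d0" "0 \<le> d1" "d0 + d1 = 1"
    and p: "0 \<le> p0" "p0 \<le> 1/2" "1/2 \<le> p1" "p1 \<le> 1" "p0 + p1 < 1"
    and b: "0 \<le> b" "b / 2 < occ0 \<gamma> d0 \<psi> p1 * (\<psi> - p0)"
  shows "0 < disc_init \<gamma> d0 + \<gamma> * p1" "a0 \<in> {p0..1/2}" "occ0 \<gamma> d0 a0 p1 * (a0 - p0) = b / 2"
    "0 < b \<Longrightarrow> \<exists>\<beta>. dual_certificate \<gamma> p0 p1 a0 p1 \<beta>"
proof -
  have psi: "\<psi> \<in> {0..1/2}" "exp_Phi \<gamma> (p0 + p1) \<psi> = exp_Phi \<gamma> (2 - p0 - p1) (1 - p1)"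
    using psi0_props[OF *(1,2) p(1-4)] by (auto simp: \<psi>_def)
  define A where "A = disc_init \<gamma> d0 + \<gamma> * p1"
  define B where "B = b / 2"
  define k where "k = 1 - \<gamma> * p0 + \<gamma> * p1"
  have den: "0 < 1 - \<gamma> * x + \<gamma> * p1" if "x \<in> {0..1}" for x
    using occ_nonneg(1)[OF * that, of p1] p by simp
  have k: "0 < k" using den[of p0] p by (simp add: k_def)
  have A0: "0 \<le> A" using * p by (simp add: A_def disc_init_def)
  have B0: "0 \<le> B" using b by (simp add: B_def)
  have lt: "B < A / (1 - \<gamma> * \<psi> + \<gamma> * p1) * (\<psi> - p0)"
    using b by (simp add: A_def B_def occ0_def)
  \<comment> \<open>The strict budget inequality excludes an unoccupied state 0, which would make
    the cost independent of \<open>a0\<close>.\<close>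
  have "A \<noteq> 0" using lt B0 by auto
  then have A: "0 < A" using A0 by simp
  then show "0 < disc_init \<gamma> d0 + \<gamma> * p1" by (simp add: A_def)
  have AB: "0 < A + \<gamma> * B" using A B0 * by (simp add: add_pos_nonneg)
  have a0: "a0 = (B * (1 + \<gamma> * p1) + p0 * A) / (A + \<gamma> * B)"
    by (simp add: a0_def eta0_plus_def A_def B_def add.commute)
  have diff: "a0 - p0 = B * k / (A + \<gamma> * B)"
    unfolding a0 k_def using AB by (simp add: field_simps)
  then have ge: "p0 \<le> a0" using B0 k AB
    by (metis diff_ge_0_iff_ge divide_nonneg_pos less_eq_real_def mult_nonneg_nonneg)
  have ad: "1 - \<gamma> * a0 + \<gamma> * p1 = A * k / (A + \<gamma> * B)"
  proof -
    have "1 - \<gamma> * a0 + \<gamma> * p1 = k - \<gamma> * (a0 - p0)" by (simp add: k_def algebra_simps)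
    also have "\<dots> = A * k / (A + \<gamma> * B)" unfolding diff using AB by (simp add: field_simps)
    finally show ?thesis .
  qed
  have "A / (A * k / q) * (B * k / q) = B" if "0 < q" for q
    using that A k by simp
  from this[OF AB] have "occ0 \<gamma> d0 a0 p1 * (a0 - p0) = B"
    unfolding occ0_def ad A_def[symmetric] diff .
  then show "occ0 \<gamma> d0 a0 p1 * (a0 - p0) = b / 2" by (simp add: B_def)
  have "a0 < \<psi>"
  proof -
    have "B * (1 - \<gamma> * \<psi> + \<gamma> * p1) < A * (\<psi> - p0)"
      using lt den[of \<psi>] psi(1) by (simp add: field_simps)
    \<comment> \<open>Adding \<open>\<gamma> * B * (\<psi> - p0)\<close> to both sides replaces the
      denominator at \<open>\<psi>\<close> by \<open>k\<close>.\<close>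
    then have "B * k < (\<psi> - p0) * (A + \<gamma> * B)" by (simp add: k_def algebra_simps)
    then have "a0 - p0 < \<psi> - p0" unfolding diff using AB by (simp add: field_simps)
    then show ?thesis by simp
  qed
  with ge psi(1) show a0_in: "a0 \<in> {p0..1/2}" by simp
  show "\<exists>\<beta>. dual_certificate \<gamma> p0 p1 a0 p1 \<beta>" if "0 < b"
  proof -
    \<comment> \<open>A positive budget moves \<open>a0\<close> off 0 even if \<open>p0 = 0\<close>,
      so the entropy has finite slope there.\<close>
    have "0 < a0 - p0" unfolding diff using that k AB by (simp add: B_def)
    then have a0_pos: "0 < a0" using p by simp
    have p1: "p1 < 1" using p by simp
    have "exp_Phi \<gamma> (p0 + p1) a0 \<le> exp_Phi \<gamma> (p0 + p1) \<psi>"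
      using exp_Phi_strict_mono[OF *(1,2) _ _ \<open>a0 < \<psi>\<close>, of "p0 + p1"] a0_pos p psi(1) by simp
    then have "exp (- Phi 1 \<gamma> p0 p1 a0) \<le> exp (- Phi (- 1) \<gamma> p0 p1 p1)"
      unfolding psi(2) using exp_Phi_plus[of a0 \<gamma> p0 p1] exp_Phi_minus[of p1 \<gamma> p0 p1] a0_pos a0_in p p1
      by simp
    then show ?thesis
      using dual_certificate_corner[OF *(1) a0_pos ge _ p(3) p1] a0_in by simp
  qed
qed

lemma b_low_plus:
  assumes "p0 + p1 < 1"
  shows "b_low \<gamma> d0 p0 p1 = 2 * (occ0 \<gamma> d0 (psi0 \<gamma> p0 p1) p1 * (psi0 \<gamma> p0 p1 - p0))"
  using assms by (simp add: b_low_def occ0_def unit_step_def mult.assoc)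

lemma b_low_minus:
  assumes "1 < p0 + p1"
  shows "b_low \<gamma> d0 p0 p1 = 2 * (occ1 \<gamma> d0 p0 (psi1 \<gamma> p0 p1) * (p1 - psi1 \<gamma> p0 p1))"
  using assms by (simp add: b_low_def occ1_def unit_step_def mult.assoc)

lemma b_low_eq_0:
  assumes "p0 + p1 = 1"
  shows "b_low \<gamma> d0 p0 p1 = 0"
  using assms by (simp add: b_low_def unit_step_def)

lemma eta0_plus_optimal:
  assumes *: "0 \<le> \<gamma>" "\<gamma> < 1" "0 \<le> d0" "0 \<le> d1" "d0 + d1 = 1"
    and p: "0 \<le> p0" "p0 \<le> 1/2" "1/2 \<le> p1" "p1 \<le> 1" "p0 + p1 < 1"
    and b: "0 \<le> b" "b < b_low \<gamma> d0 p0 p1"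
  shows "optimal_policy \<gamma> d0 d1 p0 p1 b (eta0_plus \<gamma> d0 p0 p1 b) p1"
proof -
  let ?a = "eta0_plus \<gamma> d0 p0 p1 b"
  have "b / 2 < occ0 \<gamma> d0 (psi0 \<gamma> p0 p1) p1 * (psi0 \<gamma> p0 p1 - p0)"
    using b b_low_plus[OF p(5), of \<gamma> d0] by simp
  note c = corner_policy[OF * p b(1) this]
  have a: "?a \<in> {0..1}" "p1 \<in> {0..1}" "p0 \<in> {0..1}" using c(2) p by auto
  have cost: "policy_cost \<gamma> d0 p0 p1 ?a p1 = b" using c(2,3) by simp
  show ?thesis
  proof (cases "b = 0")
    case True
    then show ?thesis using zero_budget_optimal[OF * a(3,2) a(1,2)] cost by (metis order_refl)
  next
    case False
    then obtain \<beta> where "dual_certificate \<gamma> p0 p1 ?a p1 \<beta>" using c(4) b(1) by auto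
    then show ?thesis using dual_certificate_optimal[OF * a(1,2)] cost by simp
  qed
qed

text \<open>\<open>corner_policy\<close> applied to the exchanged problem with reference actions
  \<open>1 - p1\<close>, \<open>1 - p0\<close>, whose sum is below 1; its certificate is reflected
  back.\<close>

lemma eta1_minus_optimal:
  assumes *: "0 \<le> \<gamma>" "\<gamma> < 1" "0 \<le> d0" "0 \<le> d1" "d0 + d1 = 1"
    and p: "0 \<le> p0" "p0 \<le> 1/2" "1/2 \<le> p1" "p1 \<le> 1" "1 < p0 + p1"
    and b: "0 \<le> b" "b < b_low \<gamma> d0 p0 p1"
  shows "optimal_policy \<gamma> d0 d1 p0 p1 b p0 (eta1_minus \<gamma> d0 p0 p1 b)"
proof -
  let ?a = "eta1_minus \<gamma> d0 p0 p1 b" and ?a' = "eta0_plus \<gamma> d1 (1 - p1) (1 - p0) b"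
  let ?\<psi> = "psi0 \<gamma> (1 - p1) (1 - p0)"
  note r = occ_reflect[OF *(5), of \<gamma>]
  have "b / 2 < occ1 \<gamma> d0 p0 (1 - ?\<psi>) * (p1 - (1 - ?\<psi>))"
    using b b_low_minus[OF p(5), of \<gamma> d0] unfolding psi1_eq_reflect[OF *(1,2) p(1-4)] by simp
  also have "\<dots> = occ0 \<gamma> d1 ?\<psi> (1 - p0) * (?\<psi> - (1 - p1))"
    using r[of "1 - ?\<psi>" p0] by (simp add: algebra_simps)
  finally have lt: "b / 2 < occ0 \<gamma> d1 ?\<psi> (1 - p0) * (?\<psi> - (1 - p1))" .
  have c: "0 < disc_init \<gamma> d1 + \<gamma> * (1 - p0)" "?a' \<in> {1 - p1..1/2}"
    "occ0 \<gamma> d1 ?a' (1 - p0) * (?a' - (1 - p1)) = b / 2"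
    "0 < b \<Longrightarrow> \<exists>\<beta>. dual_certificate \<gamma> (1 - p1) (1 - p0) ?a' (1 - p0) \<beta>"
    using corner_policy[of \<gamma> d1 d0 "1 - p1" "1 - p0" b] lt * p b(1) by auto
  have aa: "?a = 1 - ?a'" by (rule eta_reflect[OF *(5) c(1) *(1) b(1)])
  have a: "p0 \<in> {0..1}" "?a \<in> {0..1}" "p1 \<in> {0..1}" using c(2) p aa by auto
  have "occ1 \<gamma> d0 p0 ?a * (p1 - ?a) = b / 2"
    using c(3) r[of ?a p0] by (simp add: aa algebra_simps)
  moreover have "\<bar>?a - p1\<bar> = p1 - ?a" using c(2) aa by simp
  ultimately have cost: "policy_cost \<gamma> d0 p0 p1 p0 ?a = b" by simp
  show ?thesis
  proof (cases "b = 0")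
    case True
    then show ?thesis using zero_budget_optimal[OF * a(1,3) a(1,2)] cost by (metis order_refl)
  next
    case False
    then obtain \<beta> where "dual_certificate \<gamma> (1 - p1) (1 - p0) (1 - ?a) (1 - p0) \<beta>"
      using c(4) b(1) aa by auto
    from dual_certificate_reflect[OF this] show ?thesis
      using dual_certificate_optimal[OF * a(1,2)] cost by simp
  qed
qed

lemma S_set_optimal:
  assumes *: "0 \<le> \<gamma>" "\<gamma> < 1" "0 \<le> d0" "0 \<le> d1" "d0 + d1 = 1"
    and p: "0 \<le> p0" "p0 \<le> 1/2" "1/2 \<le> p1" "p1 \<le> 1"
    and S: "(a0, a1) \<in> S_set \<gamma> d0 p0 p1 b"
  shows "optimal_policy \<gamma> d0 d1 p0 p1 b a0 a1"
proof -
  have a: "p0 \<le> a0" "a0 \<le> 1/2" "1/2 \<le> a1" "a1 \<le> p1"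
    and bal: "Phi_minus \<gamma> p0 p1 a1 = Phi_plus \<gamma> p0 p1 a0"
    and m: "m_cost \<gamma> d0 p0 p1 a0 a1 = b / 2"
    using S by (auto simp: S_set_def)
  have u: "p0 \<in> {0..1}" "p1 \<in> {0..1}" "a0 \<in> {0..1}" "a1 \<in> {0..1}"
    and h: "a0 \<in> {0..1/2}" "a1 \<in> {1/2..1}" using a p by auto
  have "\<bar>a0 - p0\<bar> = a0 - p0" "\<bar>a1 - p1\<bar> = p1 - a1" using a by auto
  then have cost: "policy_cost \<gamma> d0 p0 p1 a0 a1 = b"
    using m by (simp add: m_cost_def)
  note eq = bal[unfolded Phi_balance_iff[OF h]]
  show ?thesis
  proof (cases "b = 0")
    case True
    then show ?thesis using zero_budget_optimal[OF * u] cost by simp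
  next
    case False
    \<comment> \<open>Balance makes both values infinite or neither. The pair \<open>(0, 1)\<close>
      would force \<open>p0 = 0\<close> and \<open>p1 = 1\<close>, hence zero cost, so for nonzero
      \<open>b\<close> both actions are interior.\<close>
    have "a0 = 0 \<longleftrightarrow> a1 = 1"
      using bal by (auto simp: Phi_minus_def Phi_plus_def split: if_splits)
    moreover have "\<not> (a0 = 0 \<and> a1 = 1)"
    proof
      assume "a0 = 0 \<and> a1 = 1"
      then have "p0 = a0" "p1 = a1" using a p by auto
      then show False using m False by (simp add: m_cost_def)
    qed
    ultimately have "a0 \<noteq> 0" "a1 \<noteq> 1" by auto
    then have i: "0 < a0" "a1 < 1" and "Phi 1 \<gamma> p0 p1 a0 = Phi (- 1) \<gamma> p0 p1 a1"
      using a p bal by (auto simp: Phi_minus_def Phi_plus_def)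
    then obtain \<beta> where "dual_certificate \<gamma> p0 p1 a0 a1 \<beta>"
      using dual_certificate_balanced[OF i(1) a i(2)] by auto
    then show ?thesis using dual_certificate_optimal[OF * u(3,4)] cost by simp
  qed
qed

text \<open>For equal actions the denominator \<open>1 - \<gamma> * a0 + \<gamma> * a1\<close> is 1;
  hence \<open>b_high\<close> contains no fraction.\<close>

lemma m_cost_half:
  assumes "0 \<le> \<gamma>" "\<gamma> < 1"
  shows "m_cost \<gamma> d0 p0 p1 (1/2) (1/2) = b_high \<gamma> d0 p0 p1 / 2"
  by (simp add: m_cost_def occ0_def occ1_def b_high_def field_simps)

text \<open>The budget does not bind, so \<open>\<beta> = 0\<close> is allowed, and the global
  entropy bound \<open>ln 2\<close> is a certificate with \<open>l = 0\<close>.\<close>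

lemma uniform_optimal:
  assumes *: "0 \<le> \<gamma>" "\<gamma> < 1" "0 \<le> d0" "0 \<le> d1" "d0 + d1 = 1"
    and p: "p0 \<le> 1/2" "1/2 \<le> p1"
    and b: "b_high \<gamma> d0 p0 p1 < b"
  shows "optimal_policy \<gamma> d0 d1 p0 p1 b (1/2) (1/2)"
proof (rule dual_certificate_optimal[OF *])
  have "\<bar>1/2 - p0\<bar> = 1/2 - p0" "\<bar>1/2 - p1\<bar> = p1 - 1/2" using p by auto
  then have "policy_cost \<gamma> d0 p0 p1 (1/2) (1/2) = b_high \<gamma> d0 p0 p1"
    using m_cost_half[OF *(1,2), of d0 p0 p1] by (simp add: m_cost_def)
  then show "policy_cost \<gamma> d0 p0 p1 (1/2) (1/2) \<le> b" using b by simp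
  show "dual_certificate \<gamma> p0 p1 (1/2) (1/2) 0"
    unfolding dual_certificate_def
    using bin_entropy_le_ln2 bin_entropy_half
    by (intro conjI exI[of _ "ln 2"] exI[of _ "0::real"]) auto
qed auto

text \<open>
  The balanced pairs form a curve, parametrized by the common value of \<open>exp (- Phi)\<close>; along it the
  cost runs continuously from \<open>b_low / 2\<close> to \<open>b_high / 2\<close>.
\<close>

lemma S_set_nonempty:
  assumes *: "0 \<le> \<gamma>" "\<gamma> < 1" "0 \<le> d0" "0 \<le> d1" "d0 + d1 = 1"
    and p: "0 \<le> p0" "p0 \<le> 1/2" "1/2 \<le> p1" "p1 \<le> 1"
    and b: "b \<in> {b_low \<gamma> d0 p0 p1..b_high \<gamma> d0 p0 p1}"
  shows "S_set \<gamma> d0 p0 p1 b \<noteq> {}"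
proof -
  define K :: real where "K = (1/2) powr (2 * \<gamma>)"
  define E0 where "E0 = exp_Phi \<gamma> (p0 + p1)"
  define E1 where "E1 = exp_Phi \<gamma> (2 - p0 - p1)"
  have c: "0 \<le> p0 + p1" "0 \<le> 2 - p0 - p1" using p by auto
  note iff0 = exp_Phi_mono_iff[OF *(1,2) c(1), folded E0_def]
  note iff1 = exp_Phi_mono_iff[OF *(1,2) c(2), folded E1_def]
  obtain f where f: "continuous_on {0..K} f"
    "\<And>t. t \<in> {0..K} \<Longrightarrow> f t \<in> {0..1/2}" "\<And>t. t \<in> {0..K} \<Longrightarrow> E0 (f t) = t"
    using exp_Phi_inverse[OF *(1,2) c(1)] unfolding K_def E0_def by metis
  obtain g where g: "continuous_on {0..K} g"
    "\<And>t. t \<in> {0..K} \<Longrightarrow> g t \<in> {0..1/2}" "\<And>t. t \<in> {0..K} \<Longrightarrow> E1 (g t) = t"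
    using exp_Phi_inverse[OF *(1,2) c(2)] unfolding K_def E1_def by metis
  have half: "E0 (1/2) = K" "E1 (1/2) = K" by (simp_all only: K_def E0_def E1_def exp_Phi_half)
  \<comment> \<open>The curve starts at the larger reference value, so that
    \<open>p0 \<le> f t\<close> and \<open>1 - g t \<le> p1\<close> both hold from \<open>T\<close>
    on.\<close>
  define T where "T = max (E0 p0) (E1 (1 - p1))"
  have T: "0 \<le> T" "T \<le> K"
    using exp_Phi_nonneg[of \<gamma> "p0 + p1" p0] iff0(1)[of p0 "1/2"] iff1(1)[of "1 - p1" "1/2"] p
    by (auto simp: T_def half E0_def[symmetric])
  then have TK: "T \<in> {0..K}" "K \<in> {0..K}" by auto
  define h where "h t = m_cost \<gamma> d0 p0 p1 (f t) (1 - g t)" for t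
  have fK: "f K = 1/2" using iff0(2)[of "f K" "1/2"] f(2,3)[OF TK(2)] half by simp
  have gK: "g K = 1/2" using iff1(2)[of "g K" "1/2"] g(2,3)[OF TK(2)] half by simp
  have hK: "h K = b_high \<gamma> d0 p0 p1 / 2"
    using m_cost_half[OF *(1,2), of d0 p0 p1] by (simp add: h_def fK gK)
  \<comment> \<open>At \<open>T\<close> at least one action equals its reference value and
    contributes no cost. The sign of \<open>p0 + p1 - 1\<close> decides which, and the other action
    is then \<open>psi0\<close> or \<open>psi1\<close>.\<close>
  have hT: "h T = b_low \<gamma> d0 p0 p1 / 2"
  proof (cases "p0 + p1" "1 :: real" rule: linorder_cases)
    case less
    have "E0 p0 \<le> E1 (1 - p1)"
      using exp_Phi_reflect_le[OF *(1,2) p(1), of "1 - p1"] less p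
      by (simp add: E0_def E1_def algebra_simps)
    then have T1: "T = E1 (1 - p1)" by (simp add: T_def)
    have "g T = 1 - p1" using iff1(2)[of "g T" "1 - p1"] g(2,3)[OF TK(1)] p T1 by simp
    moreover have "psi0 \<gamma> p0 p1 = f T"
      using psi0_eqI[OF *(1,2) p f(2)[OF TK(1)]] f(3)[OF TK(1)] T1 by (simp add: E0_def E1_def)
    ultimately show ?thesis using b_low_plus[OF less, of \<gamma> d0] by (simp add: h_def m_cost_def)
  next
    case equal
    have e: "1 - p1 = p0" "2 - p0 - p1 = p0 + p1" using equal by auto
    have "E1 (1 - p1) = E0 p0" unfolding E0_def E1_def e ..
    then have T1: "T = E0 p0" "T = E1 (1 - p1)" by (simp_all add: T_def)
    have "g T = 1 - p1" using iff1(2)[of "g T" "1 - p1"] g(2,3)[OF TK(1)] p T1 by simp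
    moreover have "f T = p0" using iff0(2)[of "f T" p0] f(2,3)[OF TK(1)] p T1 by simp
    ultimately show ?thesis using b_low_eq_0[OF equal] by (simp add: h_def m_cost_def)
  next
    case greater
    have "E1 (1 - p1) \<le> E0 p0"
      using exp_Phi_reflect_le[OF *(1,2), of "1 - p1" p0] greater p
      by (simp add: E0_def E1_def algebra_simps)
    then have T1: "T = E0 p0" by (simp add: T_def)
    have "f T = p0" using iff0(2)[of "f T" p0] f(2,3)[OF TK(1)] p T1 by simp
    moreover have "psi1 \<gamma> p0 p1 = 1 - g T"
      using psi1_eqI[OF *(1,2) p, of "1 - g T"] g(2,3)[OF TK(1)] T1 by (simp add: E0_def E1_def)
    ultimately show ?thesis using b_low_minus[OF greater, of \<gamma> d0] by (simp add: h_def m_cost_def)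
  qed
  have "continuous_on {T..K} h"
  proof -
    have sub: "{T..K} \<subseteq> {0..K}" using T by auto
    have "1 - \<gamma> * f t + \<gamma> * (1 - g t) \<noteq> 0" if "t \<in> {T..K}" for t
    proof -
      have "f t \<in> {0..1}" "1 - g t \<in> {0..1}" using f(2)[of t] g(2)[of t] that sub by auto
      from occ_nonneg(1)[OF * this] show ?thesis by simp
    qed
    then show ?thesis
      unfolding h_def[abs_def] m_cost_def occ0_def occ1_def
      by (intro continuous_intros continuous_on_subset[OF f(1) sub] continuous_on_subset[OF g(1) sub]) auto
  qed
  then obtain t where t: "T \<le> t" "t \<le> K" "h t = b / 2"
    using IVT'[of h T "b/2" K] hT hK T b by auto
  then have tK: "t \<in> {0..K}" using T by simp
  have "p0 \<le> f t"
    using iff0(1)[of p0 "f t"] f(2,3)[OF tK] t p by (simp add: T_def)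
  moreover have "1 - p1 \<le> g t"
    using iff1(1)[of "1 - p1" "g t"] g(2,3)[OF tK] t p by (simp add: T_def)
  moreover have "Phi_minus \<gamma> p0 p1 (1 - g t) = Phi_plus \<gamma> p0 p1 (f t)"
    using Phi_balance_iff[of "f t" "1 - g t" \<gamma> p0 p1] f(2,3)[OF tK] g(2,3)[OF tK]
    by (simp add: E0_def E1_def)
  ultimately have "(f t, 1 - g t) \<in> S_set \<gamma> d0 p0 p1 b"
    using t f(2)[OF tK] g(2)[OF tK] by (simp add: S_set_def h_def)
  then show ?thesis by blast
qed

theorem theorem3:
  fixes \<gamma> d0 d1 p0 p1 b :: real
  assumes "0 \<le> \<gamma>" and "\<gamma> < 1"
    and "0 \<le> d0" and "0 \<le> d1" and "d0 + d1 = 1"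
    and "p0 \<in> {0..1}" and "p1 \<in> {0..1}" and "p1 \<ge> 1/2" and "1/2 > p0"
    and "b \<ge> 0"
  shows
    "(b \<in> {0..<b_low \<gamma> d0 p0 p1} \<longrightarrow>
        (\<bar>1/2 - p1\<bar> \<ge> \<bar>1/2 - p0\<bar> \<longrightarrow>
           optimal_policy \<gamma> d0 d1 p0 p1 b p0 (eta1_minus \<gamma> d0 p0 p1 b)) \<and>
        (\<bar>1/2 - p1\<bar> < \<bar>1/2 - p0\<bar> \<longrightarrow>
           optimal_policy \<gamma> d0 d1 p0 p1 b (eta0_plus \<gamma> d0 p0 p1 b) p1)) \<and>
     (b \<in> {b_low \<gamma> d0 p0 p1..b_high \<gamma> d0 p0 p1} \<longrightarrow>
        S_set \<gamma> d0 p0 p1 b \<noteq> {} \<and>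
        (\<forall>(a0, a1) \<in> S_set \<gamma> d0 p0 p1 b. optimal_policy \<gamma> d0 d1 p0 p1 b a0 a1)) \<and>
     (b \<in> {b_high \<gamma> d0 p0 p1<..} \<longrightarrow>
        optimal_policy \<gamma> d0 d1 p0 p1 b (1/2) (1/2))"
proof (intro conjI impI ballI)
  note * = assms(1-5)
  have p: "0 \<le> p0" "p0 \<le> 1/2" "1/2 \<le> p1" "p1 \<le> 1" using assms by auto
  show "optimal_policy \<gamma> d0 d1 p0 p1 b p0 (eta1_minus \<gamma> d0 p0 p1 b)"
    if "b \<in> {0..<b_low \<gamma> d0 p0 p1}" "\<bar>1/2 - p1\<bar> \<ge> \<bar>1/2 - p0\<bar>"
  proof -
    \<comment> \<open>Equidistance from 1/2 means \<open>p0 + p1 = 1\<close>; then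
      \<open>b_low\<close> is 0 and the low-budget range is empty, so the tie never has to be
      treated.\<close>
    have "p0 + p1 \<noteq> 1" using that(1) b_low_eq_0[of p0 p1 \<gamma> d0] by auto
    moreover have "1 \<le> p0 + p1" using that(2) p by simp
    ultimately show ?thesis using that(1) eta1_minus_optimal[OF * p] by simp
  qed
  show "optimal_policy \<gamma> d0 d1 p0 p1 b (eta0_plus \<gamma> d0 p0 p1 b) p1"
    if "b \<in> {0..<b_low \<gamma> d0 p0 p1}" "\<bar>1/2 - p1\<bar> < \<bar>1/2 - p0\<bar>"
  proof -
    have "p0 + p1 < 1" using that(2) p by simp
    then show ?thesis using that(1) eta0_plus_optimal[OF * p] by simp
  qed
  show "S_set \<gamma> d0 p0 p1 b \<noteq> {}" if "b \<in> {b_low \<gamma> d0 p0 p1..b_high \<gamma> d0 p0 p1}"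
    by (rule S_set_nonempty[OF * p that])
  show "case x of (a0, a1) \<Rightarrow> optimal_policy \<gamma> d0 d1 p0 p1 b a0 a1"
    if "x \<in> S_set \<gamma> d0 p0 p1 b" for x
    using S_set_optimal[OF * p] that by auto
  show "optimal_policy \<gamma> d0 d1 p0 p1 b (1/2) (1/2)" if "b \<in> {b_high \<gamma> d0 p0 p1<..}"
    using uniform_optimal[OF * p(2,3)] that by simp
qed

end
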